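(* Let $E\to M$ be a smooth vector bundle, $K$ a linear connection on $E$, $\Gamma$ a classical (linear symmetric) connection on $M$, and let $E^{p,r}_{q,s}=\otimes^pE\otimes_M\otimes^qE^*\otimes_M\otimes^rTM\otimes_M\otimes^sT^*M$. Let $\Phi\in C^\infty(E^{p,r}_{q,s})$ be a section and let $\nabla=\nabla^{(K,\Gamma)}$. Then $$\operatorname{Alt}\nabla^2\Phi=-\tfrac12\,R[K^p_q\otimes\Gamma^r_s]\circ\Phi\ \in\ C^\infty\big(E^{p,r}_{q,s}\otimes\Lambda^2T^*M\big),$$ where $\operatorname{Alt}$ is the antisymmetrization.
   Context: All manifolds and maps are smooth; the summation convention over repeated indices is used (sums over all values of the indices). $C^\infty(F)$ denotes the smooth sections of $F\to M$. $d^\lambda=dx^\lambda$, $\partial_\lambda=\partial/\partial x^\lambda$, $\partial_i=\partial/\partial y^i$. A linear connection on a vector bundle $F\to M$ is a linear splitting $K:F\to J^1F$ (linear over $M$, section of $J^1F\to F$). Equivalently it is the tangent-valued 1-form $K=d^\lambda\otimes(\partial_\lambda+K_j{}^i{}_\lambda\,y^j\,\partial_i)$ in linear fiber coordinates $(x^\lambda,y^i)$. Its covariant differential is $\nabla^K\Phi=j^1\Phi-K\circ\Phi$, a section of $F\otimes T^*M$; in components $(\partial_\lambda\phi^i-K_j{}^i{}_\lambda\phi^j)$. A classical connection $\Gamma$ on $M$ is a linear symmetric connection on $TM$: $\Gamma=d^\lambda\otimes(\partial_\lambda+\Gamma_\nu{}^\mu{}_\lambda\dot x^\nu\,\partial/\partial\dot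 x^\mu)$, $\Gamma_\mu{}^\lambda{}_\nu=\Gamma_\nu{}^\lambda{}_\mu$. The curvature of a linear connection $K$ on $F$ is $R[K]=-[K,K]:F\to VF\otimes\Lambda^2T^*M$ (Frölicher–Nijenhuis bracket), $R[K]=R[K]_j{}^i{}_{\lambda\mu}y^j\partial_i\otimes d^\lambda\wedge d^\mu$ with $$R[K]_j{}^i{}_{\lambda\mu}=\partial_\mu K_j{}^i{}_\lambda-\partial_\lambda K_j{}^i{}_\mu+K_j{}^p{}_\mu K_p{}^i{}_\lambda-K_j{}^p{}_\lambda K_p{}^i{}_\mu .$$ Via $VF=F\times_MF$ it is regarded as a linear morphism $R[K]:F\to F\otimes\Lambda^2T^*M$ over $M$, which can be composed with a section. The dual connection $K^*$ on $F^*$ is the unique linear connection compatible with evaluation, $d\langle\Phi,\Psi\rangle=\langle\nabla^K\Phi,\Psi\rangle+\langle\Phi,\nabla^{K^*}\Psi\rangle$; $K^*=d^\lambda\otimes(\partial_\lambda-K_i{}^j{}_\lambda y_j\,\partial/\partial y_i)$. The tensor product connection $K\otimes K'$ on $F\otimes_MF'$ is the unique linear connection with $(K\otimes K')\circ\otimes=J^1\otimes\circ(K\times K')$, where $J^1\otimes:(j^1\Phi,j^1\Phi')\mapsto j^1(\Phi\otimes\Phi')$; in coordinates $K\otimes K'=d^\lambda\otimes(\partial_\lambda+(K_j{}^i{}_\lambda w^{ja}+K'_b{}^a{}_\lambda w^{ib})\,\partial/\partial w^{ia})$. By iteration one gets the linear connection $K^p_q\otimes\Gamma^r_s:=\otimes^pK\otimes\otimes^qK^*\otimes\otimes^r\Gamma\otimes\otimes^s\Gamma^*$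 on $E^{p,r}_{q,s}$. For $\Phi\in C^\infty(E^{p,r}_{q,s})$, the covariant differential with respect to the pair $(K,\Gamma)$ is $\nabla^{(K,\Gamma)}\Phi=j^1\Phi-(K^p_q\otimes\Gamma^r_s)\circ\Phi\in C^\infty(E^{p,r}_{q,s}\otimes T^*M)=C^\infty(E^{p,r}_{q,s+1})$, the differentiation index being placed last. $\nabla^2\Phi=\nabla(\nabla\Phi)\in C^\infty(E^{p,r}_{q,s}\otimes T^*M\otimes T^*M)$ is obtained by applying this twice. $\operatorname{Alt}$ acts on the last two (differentiation) factors, $T^*M\otimes T^*M\to\Lambda^2T^*M$, $d^\lambda\otimes d^\mu\mapsto d^\lambda\wedge d^\mu$, so that $\operatorname{Alt}(\phi_{;\lambda\mu}\,d^\lambda\otimes d^\mu)=\tfrac12(\phi_{;\lambda\mu}-\phi_{;\mu\lambda})\,d^\lambda\wedge d^\mu$. *)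

theory Defs
  imports "HOL-Analysis.Analysis"
begin

section \<open>Smooth functions and smooth manifolds\<close>

text \<open>Smoothness is used for open S only: the function and all its iterated
  partial derivatives are (Frechet) differentiable.\<close>

fun C_diff :: "nat \<Rightarrow> (real^'n) set \<Rightarrow> (real^'n \<Rightarrow> real) \<Rightarrow> bool" where
  "C_diff 0 S f \<longleftrightarrow> continuous_on S f"
| "C_diff (Suc k) S f \<longleftrightarrow> (\<forall>z\<in>S. f differentiable (at z)) \<and>
     (\<forall>i. C_diff k S (\<lambda>z. frechet_derivative f (at z) (axis i 1)))"

definition C_inf :: "(real^'n) set \<Rightarrow> (real^'n \<Rightarrow> real) \<Rightarrow> bool" where
  "C_inf S f \<longleftrightarrow> (\<forall>k. C_diff k S f)"

text \<open>The manifold M is the whole (Hausdorff, second countable) type \<open>'m\<close>, with an atlas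
  indexed by the set \<open>charts\<close>; \<open>cdom c\<close> is the domain and \<open>xc c\<close> the coordinate
  map of the chart c. When a vector bundle over M is considered, c indexes linear fibre charts
  $(x^\lambda, y^i)$ of the bundle: the base coordinates are stored here, the fibre coordinates in
  the bundle. Passing to a common refinement, every vector bundle over M is of this form.\<close>

record ('c, 'm, 'n) manifold =
  charts :: "'c set"
  cdom :: "'c \<Rightarrow> 'm set"
  xc :: "'c \<Rightarrow> 'm \<Rightarrow> real^('n::finite)"

definition smooth_in ::
  "('c,'m,'n::finite) manifold \<Rightarrow> 'c \<Rightarrow> 'm set \<Rightarrow> ('m \<Rightarrow> real) \<Rightarrow> bool" where
  "smooth_in M c U f \<longleftrightarrow> C_inf (xc M c ` U) (f \<circ> inv_into (cdom M c) (xc M c))"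

definition smooth_manifold ::
  "('c, 'm::{t2_space, second_countable_topology}, 'n::finite) manifold \<Rightarrow> bool" where
  "smooth_manifold M \<longleftrightarrow>
     (\<Union>c\<in>charts M. cdom M c) = UNIV \<and>
     (\<forall>c\<in>charts M. open (cdom M c) \<and> open (xc M c ` cdom M c) \<and>
        homeomorphism (cdom M c) (xc M c ` cdom M c) (xc M c) (inv_into (cdom M c) (xc M c))) \<and>
     (\<forall>c\<in>charts M. \<forall>d\<in>charts M. \<forall>\<mu>.
        smooth_in M c (cdom M c \<inter> cdom M d) (\<lambda>x. xc M d x $ \<mu>))"

text \<open>The partial derivative $\partial_\lambda f$ at x in the chart c.\<close>

definition pd ::
  "('c,'m,'n::finite) manifold \<Rightarrow> 'c \<Rightarrow> 'n \<Rightarrow> ('m \<Rightarrow> real) \<Rightarrow> 'm \<Rightarrow> real" where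
  "pd M c l f x =
     frechet_derivative (f \<circ> inv_into (cdom M c) (xc M c)) (at (xc M c x)) (axis l 1)"

section \<open>Vector bundles and sections\<close>

text \<open>Labels of fibre coordinates. A tensor product is coordinatised by pairs of labels; a single
  label type for all bundles allows tensor products to be iterated by recursion. \<open>Base l\<close> labels
  the coordinates of TM and T*M, \<open>Triv\<close> the coordinate of the trivial line bundle, and
  \<open>Fib k\<close> is available for the coordinates of a given bundle.\<close>

datatype 'n idx = Triv | Fib nat | Base 'n | Pair "'n idx" "'n idx"

text \<open>A bundle is given by its fibres \<open>fib F x\<close> with their linear operations, the finite set
  \<open>fidx F\<close> of fibre coordinate labels (its cardinality is the rank, possibly 0), and the linear
  fibre coordinates \<open>crd F c x v i\<close> $= y^i(v)$ of a vector v of the fibre over x in the chart c.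
  The total space is the disjoint union of the fibres, with the manifold structure given by the
  charts $(x^\lambda, y^i)$.\<close>

record ('c, 'm, 'n, 'v) vbundle =
  fidx :: "'n idx set"
  fib :: "'m \<Rightarrow> 'v set"
  vadd :: "'m \<Rightarrow> 'v \<Rightarrow> 'v \<Rightarrow> 'v"
  vscale :: "'m \<Rightarrow> real \<Rightarrow> 'v \<Rightarrow> 'v"
  crd :: "'c \<Rightarrow> 'm \<Rightarrow> 'v \<Rightarrow> 'n idx \<Rightarrow> real"

definition frame :: "('c,'m,'n,'v) vbundle \<Rightarrow> 'c \<Rightarrow> 'm \<Rightarrow> 'n idx \<Rightarrow> 'v" where
  "frame F c x j = (THE v. v \<in> fib F x \<and> crd F c x v = (\<lambda>i. if i = j then 1 else 0))"

text \<open>Transition matrices: $y_c^i = \sum_j (\mathrm{trans}\,c\,d)^i_j\, y_d^j$.\<close>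

definition trans_fn ::
  "('c,'m,'n,'v) vbundle \<Rightarrow> 'c \<Rightarrow> 'c \<Rightarrow> 'm \<Rightarrow> 'n idx \<Rightarrow> 'n idx \<Rightarrow> real" where
  "trans_fn F c d x i j = crd F c x (frame F d x j) i"

definition vector_bundle ::
  "('c,'m,'n::finite) manifold \<Rightarrow> ('c,'m,'n,'v) vbundle \<Rightarrow> bool" where
  "vector_bundle M F \<longleftrightarrow> finite (fidx F) \<and>
     (\<forall>x. \<forall>u\<in>fib F x. \<forall>v\<in>fib F x. vadd F x u v \<in> fib F x) \<and>
     (\<forall>x a. \<forall>v\<in>fib F x. vscale F x a v \<in> fib F x) \<and>
     (\<forall>c\<in>charts M. \<forall>x\<in>cdom M c.
        bij_betw (crd F c x) (fib F x) {f. \<forall>i. i \<notin> fidx F \<longrightarrow> f i = 0} \<and>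
        (\<forall>u\<in>fib F x. \<forall>v\<in>fib F x. \<forall>i.
           crd F c x (vadd F x u v) i = crd F c x u i + crd F c x v i) \<and>
        (\<forall>a. \<forall>v\<in>fib F x. \<forall>i. crd F c x (vscale F x a v) i = a * crd F c x v i)) \<and>
     (\<forall>c\<in>charts M. \<forall>d\<in>charts M. \<forall>i\<in>fidx F. \<forall>j\<in>fidx F.
        smooth_in M c (cdom M c \<inter> cdom M d) (\<lambda>x. trans_fn F c d x i j))"

definition sections ::
  "('c,'m,'n::finite) manifold \<Rightarrow> ('c,'m,'n,'v) vbundle \<Rightarrow> ('m \<Rightarrow> 'v) set" where
  "sections M F = {s. (\<forall>x. s x \<in> fib F x) \<and>
     (\<forall>c\<in>charts M. \<forall>i\<in>fidx F. smooth_in M c (cdom M c) (\<lambda>x. crd F c x (s x) i))}"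

definition local_section ::
  "('c,'m::topological_space,'n::finite) manifold \<Rightarrow> ('c,'m,'n,'v) vbundle \<Rightarrow> 'm \<Rightarrow> ('m \<Rightarrow> 'v) \<Rightarrow> bool"
  where
  "local_section M F x s \<longleftrightarrow> (\<exists>U. open U \<and> x \<in> U \<and> (\<forall>y\<in>U. s y \<in> fib F y) \<and>
     (\<forall>c\<in>charts M. \<forall>i\<in>fidx F. smooth_in M c (U \<inter> cdom M c) (\<lambda>y. crd F c y (s y) i)))"

section \<open>Trivial, tangent, dual and tensor product bundles\<close>

text \<open>The vector bundle with coordinate labels I and transition matrices G. A vector over x is the
  family of its coordinate arrays in all charts around x, related by the transition matrices (and
  0 in the charts not containing x). A tangent vector, for instance, is the family of its
  components in all charts. All bundles constructed this way have fibres in one type.\<close>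

type_synonym ('c, 'n) arrays = "'c \<Rightarrow> 'n idx \<Rightarrow> real"

definition assoc_bundle ::
  "('c,'m,'n::finite) manifold \<Rightarrow> 'n idx set \<Rightarrow> ('c \<Rightarrow> 'c \<Rightarrow> 'm \<Rightarrow> 'n idx \<Rightarrow> 'n idx \<Rightarrow> real)
     \<Rightarrow> ('c,'m,'n,('c,'n) arrays) vbundle" where
  "assoc_bundle M I G =
     \<lparr> fidx = I,
       fib = (\<lambda>x. {w. (\<forall>c i. c \<notin> charts M \<or> x \<notin> cdom M c \<or> i \<notin> I \<longrightarrow> w c i = 0) \<and>
                (\<forall>c\<in>charts M. \<forall>d\<in>charts M. x \<in> cdom M c \<inter> cdom M d \<longrightarrow>
                   (\<forall>i\<in>I. w c i = (\<Sum>j\<in>I. G c d x i j * w d j)))}),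
       vadd = (\<lambda>x u v c i. u c i + v c i),
       vscale = (\<lambda>x a v c i. a * v c i),
       crd = (\<lambda>c x w. w c) \<rparr>"

definition trivial_bundle ::
  "('c,'m,'n::finite) manifold \<Rightarrow> ('c,'m,'n,('c,'n) arrays) vbundle" where
  "trivial_bundle M = assoc_bundle M {Triv} (\<lambda>c d x i j. 1)"

text \<open>$\dot x_c^\lambda = (\partial x_c^\lambda / \partial x_d^\mu)\, \dot x_d^\mu$.\<close>

definition tangent_bundle ::
  "('c,'m,'n::finite) manifold \<Rightarrow> ('c,'m,'n,('c,'n) arrays) vbundle" where
  "tangent_bundle M = assoc_bundle M (range Base)
     (\<lambda>c d x i j. case (i, j) of (Base l, Base m) \<Rightarrow> pd M d m (\<lambda>y. xc M c y $ l) x | _ \<Rightarrow> 0)"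

text \<open>Invariance of the pairing $y_i\, y^i$ forces the inverse transposed transition matrices.\<close>

definition dual_bundle ::
  "('c,'m,'n::finite) manifold \<Rightarrow> ('c,'m,'n,'v) vbundle \<Rightarrow> ('c,'m,'n,('c,'n) arrays) vbundle" where
  "dual_bundle M F = assoc_bundle M (fidx F) (\<lambda>c d x i j. trans_fn F d c x j i)"

definition prod_bundle ::
  "('c,'m,'n::finite) manifold \<Rightarrow> ('c,'m,'n,'v) vbundle \<Rightarrow> ('c,'m,'n,'w) vbundle
     \<Rightarrow> ('c,'m,'n,('c,'n) arrays) vbundle" where
  "prod_bundle M F F' = assoc_bundle M {Pair i a | i a. i \<in> fidx F \<and> a \<in> fidx F'}
     (\<lambda>c d x k l. case (k, l) of
        (Pair i a, Pair j b) \<Rightarrow> trans_fn F c d x i j * trans_fn F' c d x a b | _ \<Rightarrow> 0)"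

abbreviation cotangent_bundle ::
  "('c,'m,'n::finite) manifold \<Rightarrow> ('c,'m,'n,('c,'n) arrays) vbundle" where
  "cotangent_bundle M \<equiv> dual_bundle M (tangent_bundle M)"

text \<open>\<open>prod_power M F G k\<close> is $(\dots((F \otimes G) \otimes G) \dots) \otimes G$ with k factors G.\<close>

primrec prod_power ::
  "('c,'m,'n::finite) manifold \<Rightarrow> ('c,'m,'n,('c,'n) arrays) vbundle \<Rightarrow> ('c,'m,'n,'w) vbundle \<Rightarrow> nat
     \<Rightarrow> ('c,'m,'n,('c,'n) arrays) vbundle" where
  "prod_power M F G 0 = F"
| "prod_power M F G (Suc k) = prod_bundle M (prod_power M F G k) G"

text \<open>\<open>tensor_bundle M E p q r s\<close> is $E^{p,r}_{q,s}$, the factors being associated to the left and preceded by the trivial line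
  bundle (which is all that remains for p = q = r = s = 0). In this way
  $E^{p,r}_{q,s+1} = E^{p,r}_{q,s} \otimes T^*M$ holds by definition.\<close>

definition tensor_bundle ::
  "('c,'m,'n::finite) manifold \<Rightarrow> ('c,'m,'n,'v) vbundle \<Rightarrow> nat \<Rightarrow> nat \<Rightarrow> nat \<Rightarrow> nat
     \<Rightarrow> ('c,'m,'n,('c,'n) arrays) vbundle" where
  "tensor_bundle M E p q r s =
     prod_power M (prod_power M (prod_power M (prod_power M (trivial_bundle M)
       E p) (dual_bundle M E) q) (tangent_bundle M) r) (cotangent_bundle M) s"

section \<open>Jets and linear connections\<close>

text \<open>The first jet of the local section s at x is identified with the family of its coordinates
  $(y^i, y^i_\lambda) = (s^i(x), \partial_\lambda s^i(x))$ in all charts around x; two local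
  sections have the same first jet at x iff these families agree.\<close>

type_synonym ('c, 'n) jet = "'c \<Rightarrow> ('n idx \<Rightarrow> real) \<times> ('n \<Rightarrow> 'n idx \<Rightarrow> real)"

definition j1 ::
  "('c,'m,'n::finite) manifold \<Rightarrow> ('c,'m,'n,'v) vbundle \<Rightarrow> ('m \<Rightarrow> 'v) \<Rightarrow> 'm \<Rightarrow> ('c,'n) jet" where
  "j1 M F s x = (\<lambda>c. if c \<in> charts M \<and> x \<in> cdom M c
     then (\<lambda>i. if i \<in> fidx F then crd F c x (s x) i else 0,
           \<lambda>l i. if i \<in> fidx F then pd M c l (\<lambda>y. crd F c y (s y) i) x else 0)
     else (\<lambda>i. 0, \<lambda>l i. 0))"

text \<open>The fibre of $J^1F \to F$ over the vector v at x.\<close>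

definition J1_over ::
  "('c,'m::topological_space,'n::finite) manifold \<Rightarrow> ('c,'m,'n,'v) vbundle \<Rightarrow> 'm \<Rightarrow> 'v
     \<Rightarrow> ('c,'n) jet set" where
  "J1_over M F x v = {j1 M F s x | s. local_section M F x s \<and> s x = v}"

text \<open>The linear operations of the vector bundle $J^1F \to M$, i.e.
  $j^1_x s + j^1_x s' = j^1_x(s + s')$ and $a\, j^1_x s = j^1_x(a s)$.\<close>

definition jet_add :: "('c,'n) jet \<Rightarrow> ('c,'n) jet \<Rightarrow> ('c,'n) jet" where
  "jet_add u v = (\<lambda>c. (\<lambda>i. fst (u c) i + fst (v c) i, \<lambda>l i. snd (u c) l i + snd (v c) l i))"

definition jet_scale :: "real \<Rightarrow> ('c,'n) jet \<Rightarrow> ('c,'n) jet" where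
  "jet_scale a u = (\<lambda>c. (\<lambda>i. a * fst (u c) i, \<lambda>l i. a * snd (u c) l i))"

text \<open>\<open>coef F K c j i l x\<close> is the coefficient $K_j{}^i{}_\lambda$ at x in the chart c: the
  coordinate $y^i_\lambda$ of K applied to the j-th frame vector.\<close>

definition coef ::
  "('c,'m,'n,'v) vbundle \<Rightarrow> ('m \<Rightarrow> 'v \<Rightarrow> ('c,'n) jet) \<Rightarrow> 'c \<Rightarrow> 'n idx \<Rightarrow> 'n idx \<Rightarrow> 'n \<Rightarrow> 'm \<Rightarrow> real"
  where
  "coef F K c j i l x = snd (K x (frame F c x j) c) l i"

text \<open>A smooth linear splitting $K : F \to J^1F$. Being linear, K is smooth iff its coefficients
  are.\<close>

definition linear_connection ::
  "('c,'m::topological_space,'n::finite) manifold \<Rightarrow> ('c,'m,'n,'v) vbundle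
     \<Rightarrow> ('m \<Rightarrow> 'v \<Rightarrow> ('c,'n) jet) \<Rightarrow> bool" where
  "linear_connection M F K \<longleftrightarrow>
     (\<forall>x. \<forall>v\<in>fib F x. K x v \<in> J1_over M F x v) \<and>
     (\<forall>x. \<forall>u\<in>fib F x. \<forall>v\<in>fib F x. K x (vadd F x u v) = jet_add (K x u) (K x v)) \<and>
     (\<forall>x a. \<forall>v\<in>fib F x. K x (vscale F x a v) = jet_scale a (K x v)) \<and>
     (\<forall>c\<in>charts M. \<forall>j\<in>fidx F. \<forall>i\<in>fidx F. \<forall>l. smooth_in M c (cdom M c) (coef F K c j i l))"

definition classical_connection ::
  "('c,'m::topological_space,'n::finite) manifold \<Rightarrow> ('m \<Rightarrow> ('c,'n) arrays \<Rightarrow> ('c,'n) jet) \<Rightarrow> bool"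
  where
  "classical_connection M \<Gamma> \<longleftrightarrow> linear_connection M (tangent_bundle M) \<Gamma> \<and>
     (\<forall>c\<in>charts M. \<forall>x\<in>cdom M c. \<forall>l m n.
        coef (tangent_bundle M) \<Gamma> c (Base m) (Base l) n x =
        coef (tangent_bundle M) \<Gamma> c (Base n) (Base l) m x)"

text \<open>The flat connection of the trivial line bundle.\<close>

definition trivial_connection ::
  "('c,'m,'n::finite) manifold \<Rightarrow> 'm \<Rightarrow> ('c,'n) arrays \<Rightarrow> ('c,'n) jet" where
  "trivial_connection M x w = (\<lambda>c. (w c, \<lambda>l i. 0))"

text \<open>The dual connection: $y_{i\lambda} = -K_i{}^j{}_\lambda\, y_j$.\<close>

definition dual_connection ::
  "('c,'m,'n::finite) manifold \<Rightarrow> ('c,'m,'n,'v) vbundle \<Rightarrow> ('m \<Rightarrow> 'v \<Rightarrow> ('c,'n) jet)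
     \<Rightarrow> 'm \<Rightarrow> ('c,'n) arrays \<Rightarrow> ('c,'n) jet" where
  "dual_connection M F K x w = (\<lambda>c. (w c, \<lambda>l i.
     if c \<in> charts M \<and> x \<in> cdom M c \<and> i \<in> fidx F
     then - (\<Sum>j\<in>fidx F. coef F K c i j l x * w c j) else 0))"

text \<open>The tensor product connection:
  $w^{ia}_\lambda = K_j{}^i{}_\lambda\, w^{ja} + K'_b{}^a{}_\lambda\, w^{ib}$.\<close>

definition prod_connection ::
  "('c,'m,'n::finite) manifold \<Rightarrow> ('c,'m,'n,'v) vbundle \<Rightarrow> ('c,'m,'n,'w) vbundle
     \<Rightarrow> ('m \<Rightarrow> 'v \<Rightarrow> ('c,'n) jet) \<Rightarrow> ('m \<Rightarrow> 'w \<Rightarrow> ('c,'n) jet)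
     \<Rightarrow> 'm \<Rightarrow> ('c,'n) arrays \<Rightarrow> ('c,'n) jet" where
  "prod_connection M F F' K K' x w = (\<lambda>c. (w c, \<lambda>l k. case k of
     Pair i a \<Rightarrow>
       if c \<in> charts M \<and> x \<in> cdom M c \<and> i \<in> fidx F \<and> a \<in> fidx F'
       then (\<Sum>j\<in>fidx F. coef F K c j i l x * w c (Pair j a)) +
            (\<Sum>b\<in>fidx F'. coef F' K' c b a l x * w c (Pair i b))
       else 0
   | _ \<Rightarrow> 0))"

primrec prod_power_connection ::
  "('c,'m,'n::finite) manifold \<Rightarrow> ('c,'m,'n,('c,'n) arrays) vbundle \<Rightarrow> ('c,'m,'n,'w) vbundle
     \<Rightarrow> ('m \<Rightarrow> ('c,'n) arrays \<Rightarrow> ('c,'n) jet) \<Rightarrow> ('m \<Rightarrow> 'w \<Rightarrow> ('c,'n) jet) \<Rightarrow> nat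
     \<Rightarrow> 'm \<Rightarrow> ('c,'n) arrays \<Rightarrow> ('c,'n) jet" where
  "prod_power_connection M F G K L 0 = K"
| "prod_power_connection M F G K L (Suc k) =
     prod_connection M (prod_power M F G k) G (prod_power_connection M F G K L k) L"

text \<open>$K^p_q \otimes \Gamma^r_s$, following the construction of $E^{p,r}_{q,s}$.\<close>

definition tensor_connection ::
  "('c,'m,'n::finite) manifold \<Rightarrow> ('c,'m,'n,'v) vbundle
     \<Rightarrow> ('m \<Rightarrow> 'v \<Rightarrow> ('c,'n) jet) \<Rightarrow> ('m \<Rightarrow> ('c,'n) arrays \<Rightarrow> ('c,'n) jet)
     \<Rightarrow> nat \<Rightarrow> nat \<Rightarrow> nat \<Rightarrow> nat \<Rightarrow> 'm \<Rightarrow> ('c,'n) arrays \<Rightarrow> ('c,'n) jet" where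
  "tensor_connection M E K \<Gamma> p q r s =
     (let E1 = prod_power M (trivial_bundle M) E p;
          E2 = prod_power M E1 (dual_bundle M E) q;
          E3 = prod_power M E2 (tangent_bundle M) r;
          K1 = prod_power_connection M (trivial_bundle M) E (trivial_connection M) K p;
          K2 = prod_power_connection M E1 (dual_bundle M E) K1 (dual_connection M E K) q;
          K3 = prod_power_connection M E2 (tangent_bundle M) K2 \<Gamma> r
      in prod_power_connection M E3 (cotangent_bundle M) K3
           (dual_connection M (tangent_bundle M) \<Gamma>) s)"

section \<open>Covariant differential, antisymmetrisation and curvature\<close>

text \<open>$\nabla^K\Phi = j^1\Phi - K \circ \Phi$. Two jets over the same vector differ by the element
  $(y^i_\lambda - \bar y^i_\lambda)\, \partial_i \otimes d^\lambda$ of $F \otimes T^*M$.\<close>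

definition cov_diff ::
  "('c,'m,'n::finite) manifold \<Rightarrow> ('c,'m,'n,'v) vbundle \<Rightarrow> ('m \<Rightarrow> 'v \<Rightarrow> ('c,'n) jet)
     \<Rightarrow> ('m \<Rightarrow> 'v) \<Rightarrow> 'm \<Rightarrow> ('c,'n) arrays" where
  "cov_diff M F K \<Phi> x = (\<lambda>c k. case k of
     Pair i (Base l) \<Rightarrow>
       if c \<in> charts M \<and> x \<in> cdom M c \<and> i \<in> fidx F
       then snd (j1 M F \<Phi> x c) l i - snd (K x (\<Phi> x) c) l i else 0
   | _ \<Rightarrow> 0)"

text \<open>The covariant differential with respect to the pair (K, Gamma); it maps sections of
  $E^{p,r}_{q,s}$ to sections of $E^{p,r}_{q,s+1}$.\<close>

definition nabla ::
  "('c,'m,'n::finite) manifold \<Rightarrow> ('c,'m,'n,'v) vbundle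
     \<Rightarrow> ('m \<Rightarrow> 'v \<Rightarrow> ('c,'n) jet) \<Rightarrow> ('m \<Rightarrow> ('c,'n) arrays \<Rightarrow> ('c,'n) jet)
     \<Rightarrow> nat \<Rightarrow> nat \<Rightarrow> nat \<Rightarrow> nat \<Rightarrow> ('m \<Rightarrow> ('c,'n) arrays) \<Rightarrow> 'm \<Rightarrow> ('c,'n) arrays" where
  "nabla M E K \<Gamma> p q r s =
     cov_diff M (tensor_bundle M E p q r s) (tensor_connection M E K \<Gamma> p q r s)"

text \<open>$F \otimes \Lambda^2T^*M$ is realised as the subbundle of $F \otimes T^*M \otimes T^*M$ of the
  tensors antisymmetric in the last two factors, with
  $d^\lambda \wedge d^\mu = \frac12(d^\lambda \otimes d^\mu - d^\mu \otimes d^\lambda)$, the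
  convention for which Alt (that is, $d^\lambda \otimes d^\mu \mapsto d^\lambda \wedge d^\mu$) is the
  antisymmetrisation. So $A_{\lambda\mu}\, d^\lambda \wedge d^\mu$, summed over all indices with
  $A$ antisymmetric, has the components $A_{\lambda\mu}$.\<close>

definition sections_wedge2 ::
  "('c,'m,'n::finite) manifold \<Rightarrow> ('c,'m,'n,'v) vbundle \<Rightarrow> ('m \<Rightarrow> ('c,'n) arrays) set" where
  "sections_wedge2 M F =
     {\<Psi> \<in> sections M (prod_bundle M (prod_bundle M F (cotangent_bundle M)) (cotangent_bundle M)).
        \<forall>x c i l m. \<Psi> x c (Pair (Pair i l) m) = - \<Psi> x c (Pair (Pair i m) l)}"

definition Alt :: "('m \<Rightarrow> ('c,'n) arrays) \<Rightarrow> 'm \<Rightarrow> ('c,'n) arrays" where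
  "Alt \<Psi> x c k = (case k of
     Pair (Pair i l) m \<Rightarrow> (\<Psi> x c (Pair (Pair i l) m) - \<Psi> x c (Pair (Pair i m) l)) / 2
   | _ \<Rightarrow> 0)"

text \<open>The components $R[K]_j{}^i{}_{\lambda\mu}$ at x in the chart c.\<close>

definition curv_coef ::
  "('c,'m,'n::finite) manifold \<Rightarrow> ('c,'m,'n,'v) vbundle \<Rightarrow> ('m \<Rightarrow> 'v \<Rightarrow> ('c,'n) jet)
     \<Rightarrow> 'c \<Rightarrow> 'n idx \<Rightarrow> 'n idx \<Rightarrow> 'n \<Rightarrow> 'n \<Rightarrow> 'm \<Rightarrow> real" where
  "curv_coef M F K c j i l m x =
     pd M c m (coef F K c j i l) x - pd M c l (coef F K c j i m) x +
     (\<Sum>p\<in>fidx F. coef F K c j p m x * coef F K c p i l x) -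
     (\<Sum>p\<in>fidx F. coef F K c j p l x * coef F K c p i m x)"

text \<open>The curvature as a linear morphism $F \to F \otimes \Lambda^2T^*M$ over M,
  $v \mapsto R[K]_j{}^i{}_{\lambda\mu}\, y^j(v)\, \partial_i \otimes d^\lambda \wedge d^\mu$.\<close>

definition curvature ::
  "('c,'m,'n::finite) manifold \<Rightarrow> ('c,'m,'n,'v) vbundle \<Rightarrow> ('m \<Rightarrow> 'v \<Rightarrow> ('c,'n) jet)
     \<Rightarrow> 'm \<Rightarrow> 'v \<Rightarrow> ('c,'n) arrays" where
  "curvature M F K x v = (\<lambda>c k. case k of
     Pair (Pair i (Base l)) (Base m) \<Rightarrow>
       if c \<in> charts M \<and> x \<in> cdom M c \<and> i \<in> fidx F
       then (\<Sum>j\<in>fidx F. curv_coef M F K c j i l m x * crd F c x v j) else 0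
   | _ \<Rightarrow> 0)"

end

theory Submission
  imports Defs
begin

text \<open>The first half is local. In a chart write $\nabla_\lambda\phi = \partial_\lambda\phi - A_\lambda\phi$ with the
  matrices $(A_\lambda)^i{}_j = K_j{}^i{}_\lambda$ of a connection on a bundle F. The second differentiation is that of
  $F \otimes T^*M$, so
  \[ \nabla_\mu\nabla_\lambda\phi = \partial_\mu\partial_\lambda\phi - (\partial_\mu A_\lambda)\phi
       - (A_\lambda\partial_\mu\phi + A_\mu\partial_\lambda\phi) + A_\mu A_\lambda\phi
       + \Gamma_\lambda{}^\nu{}_\mu\nabla_\nu\phi . \]
  Second partial derivatives commute, the bracket is symmetric in $\lambda, \mu$, and so is the last term, because
  $\Gamma$ is a symmetric connection. What survives antisymmetrisation is
  $\frac12(\partial_\lambda A_\mu - \partial_\mu A_\lambda + A_\mu A_\lambda - A_\lambda A_\mu)\phi$, which is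
  $-\frac12 R\,\phi$. The computation (\<open>second_cov_diff_components\<close>, \<open>Alt_second_cov_diff\<close>) is done for any
  bundle with a connection; the theorem is the case where the connection is $K^p_q \otimes \Gamma^r_s$.

  The second half says that these components, computed chart by chart, belong to one tensor field. This rests on
  the transformation law of a connection: if $y_c = G\,y_d$ are the fibre coordinates in two charts, then
  $A_c G = \partial G + G B$, where B is the matrix of the d-coefficients with the form index transformed to c. Given
  the law, the inhomogeneous term $\partial G$ cancels against the one in the derivative of a section, and
  $\nabla\phi$ transforms like a section of $F \otimes T^*M$ (\<open>cov_diff_change_chart\<close>). For K and $\Gamma$ the law holds since
  their values are jets of local sections (\<open>linear_connection_imp_diff_connection\<close>); it passes to duals
  (\<open>dual_diff_connection\<close>) and to tensor products (\<open>prod_diff_connection\<close>), hence to $K^p_q \otimes \Gamma^r_s$.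

  A section is smooth when its components in each chart are smooth in that same chart. So the
  change of charts enters only through first derivatives of transition matrices at single points, and these are
  carried from chart to chart by the ordinary chain rule.\<close>

section \<open>Symmetry of second derivatives\<close>

text \<open>The mean value theorem, applied to the difference of f along two segments parallel to a, turns the
  second difference into h times an increment of the derivative of f along a; differentiability of this derivative at
  the single point x then gives the value $h^2 g'(b)$ up to $o(h^2)$.\<close>

lemma second_difference_estimate:
  fixes f :: "'a::real_normed_vector \<Rightarrow> real"
  assumes r: "r > 0" and f: "\<And>z. z \<in> ball x r \<Longrightarrow> f differentiable (at z)"
    and g: "((\<lambda>z. frechet_derivative f (at z) a) has_derivative g') (at x)"
    and e: "e > 0"
  shows "\<exists>\<delta>>0. \<forall>h. 0 < h \<and> h < \<delta> \<longrightarrow>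
    \<bar>f (x + h *\<^sub>R a + h *\<^sub>R b) - f (x + h *\<^sub>R a) - f (x + h *\<^sub>R b) + f x - h\<^sup>2 * g' b\<bar> \<le> e * h\<^sup>2"
proof -
  define g where "g = (\<lambda>z. frechet_derivative f (at z) a)"
  \<comment> \<open>All points used have the form x + t a + u b with t, u in [0, h], so they lie within h C of x.\<close>
  define C where "C = norm a + norm b + 1"
  have C: "C > 0" unfolding C_def using norm_ge_zero[of a] norm_ge_zero[of b] by linarith
  have e': "e / (2 * C) > 0" using e C by simp
  interpret g': bounded_linear g' using g by (rule has_derivative_bounded_linear)
  obtain d where d: "d > 0"
    "\<And>y. norm (y - x) < d \<Longrightarrow> \<bar>g y - g x - g' (y - x)\<bar> \<le> e / (2 * C) * norm (y - x)"
    using g e' unfolding has_derivative_at_alt g_def real_norm_def by blast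
  define \<delta> where "\<delta> = min d r / C"
  have \<delta>: "\<delta> > 0" using d(1) r C by (simp add: \<delta>_def)
  moreover have "\<bar>f (x + h *\<^sub>R a + h *\<^sub>R b) - f (x + h *\<^sub>R a) - f (x + h *\<^sub>R b) + f x - h\<^sup>2 * g' b\<bar>
      \<le> e * h\<^sup>2" if h: "0 < h" "h < \<delta>" for h
  proof -
    have hC: "h * C < d" "h * C < r"
      using h C by (simp_all add: \<delta>_def pos_less_divide_eq)
    have small: "norm (t *\<^sub>R a + u *\<^sub>R b) \<le> h * C" if "0 \<le> t" "t \<le> h" "0 \<le> u" "u \<le> h" for t u
    proof -
      have "norm (t *\<^sub>R a + u *\<^sub>R b) \<le> t * norm a + u * norm b"
        using norm_triangle_ineq[of "t *\<^sub>R a" "u *\<^sub>R b"] that by simp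
      also have "\<dots> \<le> h * norm a + h * norm b"
        using that by (intro add_mono mult_right_mono) auto
      also have "\<dots> \<le> h * C" using h by (simp add: C_def algebra_simps)
      finally show ?thesis .
    qed
    have line: "((\<lambda>t. f (x + t *\<^sub>R a + u *\<^sub>R b)) has_real_derivative g (x + t *\<^sub>R a + u *\<^sub>R b)) (at t)"
      if "0 \<le> t" "t \<le> h" "0 \<le> u" "u \<le> h" for t u
    proof -
      have "x + t *\<^sub>R a + u *\<^sub>R b \<in> ball x r"
        using small[OF that] hC by (simp add: dist_norm algebra_simps norm_minus_commute)
      then have fd: "(f has_derivative frechet_derivative f (at (x + t *\<^sub>R a + u *\<^sub>R b))) (at (x + t *\<^sub>R a + u *\<^sub>R b))"
        using f frechet_derivative_works by blast
      have "((\<lambda>t. x + t *\<^sub>R a + u *\<^sub>R b) has_derivative (\<lambda>s. s *\<^sub>R a)) (at t)"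
        by (auto intro!: derivative_eq_intros)
      from has_derivative_compose[OF this fd]
      have "((\<lambda>t. f (x + t *\<^sub>R a + u *\<^sub>R b)) has_derivative
          (\<lambda>s. frechet_derivative f (at (x + t *\<^sub>R a + u *\<^sub>R b)) (s *\<^sub>R a))) (at t)" .
      moreover have "frechet_derivative f (at (x + t *\<^sub>R a + u *\<^sub>R b)) (s *\<^sub>R a) =
          g (x + t *\<^sub>R a + u *\<^sub>R b) * s" for s
        using linear_cmul[OF has_derivative_linear[OF fd], of s a] by (simp add: g_def mult.commute)
      ultimately show ?thesis by (simp add: has_field_derivative_def)
    qed
    have "\<exists>z>0. z < h \<and> (f (x + h *\<^sub>R a + h *\<^sub>R b) - f (x + h *\<^sub>R a + 0 *\<^sub>R b))
          - (f (x + 0 *\<^sub>R a + h *\<^sub>R b) - f (x + 0 *\<^sub>R a + 0 *\<^sub>R b))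
          = (h - 0) * (g (x + z *\<^sub>R a + h *\<^sub>R b) - g (x + z *\<^sub>R a + 0 *\<^sub>R b))"
      using h by (intro MVT2 DERIV_diff line) auto
    then obtain z where z: "0 < z" "z < h"
      and mv: "f (x + h *\<^sub>R a + h *\<^sub>R b) - f (x + h *\<^sub>R a) - f (x + h *\<^sub>R b) + f x
          = h * (g (x + z *\<^sub>R a + h *\<^sub>R b) - g (x + z *\<^sub>R a))"
      by (auto simp: algebra_simps)
    have near: "\<bar>g (x + z *\<^sub>R a + u *\<^sub>R b) - g x - (z * g' a + u * g' b)\<bar> \<le> e / 2 * h"
      if "0 \<le> u" "u \<le> h" for u
    proof -
      have n: "norm (z *\<^sub>R a + u *\<^sub>R b) \<le> h * C" using small z that by auto
      have "\<bar>g (x + z *\<^sub>R a + u *\<^sub>R b) - g x - (z * g' a + u * g' b)\<bar>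
          \<le> e / (2 * C) * norm (z *\<^sub>R a + u *\<^sub>R b)"
        using d(2)[of "x + z *\<^sub>R a + u *\<^sub>R b"] n hC by (simp add: g'.add g'.scaleR add.assoc)
      also have "\<dots> \<le> e / (2 * C) * (h * C)" using n e' by (intro mult_left_mono) auto
      also have "\<dots> = e / 2 * h" using C by simp
      finally show ?thesis .
    qed
    have "\<bar>(g (x + z *\<^sub>R a + h *\<^sub>R b) - g (x + z *\<^sub>R a)) - h * g' b\<bar> \<le> e * h"
    proof -
      have "\<bar>g (x + z *\<^sub>R a) - g x - z * g' a\<bar> \<le> e / 2 * h" using near[of 0] h by simp
      moreover have "\<bar>g (x + z *\<^sub>R a + h *\<^sub>R b) - g x - (z * g' a + h * g' b)\<bar> \<le> e / 2 * h"
        using near[of h] h by simp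
      ultimately show ?thesis by linarith
    qed
    then have "h * \<bar>(g (x + z *\<^sub>R a + h *\<^sub>R b) - g (x + z *\<^sub>R a)) - h * g' b\<bar> \<le> h * (e * h)"
      using h by (intro mult_left_mono) auto
    moreover have "f (x + h *\<^sub>R a + h *\<^sub>R b) - f (x + h *\<^sub>R a) - f (x + h *\<^sub>R b) + f x - h\<^sup>2 * g' b
        = h * (g (x + z *\<^sub>R a + h *\<^sub>R b) - g (x + z *\<^sub>R a) - h * g' b)"
      unfolding mv by (simp add: power2_eq_square algebra_simps)
    ultimately show ?thesis using h by (simp add: abs_mult power2_eq_square mult_ac)
  qed
  ultimately show ?thesis by blast
qed

text \<open>The second difference does not change when a and b are exchanged, so both mixed derivatives are its
  limit after division by $h^2$.\<close>

lemma second_derivative_symmetric: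
  fixes f :: "'a::real_normed_vector \<Rightarrow> real"
  assumes "open S" "x \<in> S" and f: "\<And>z. z \<in> S \<Longrightarrow> f differentiable (at z)"
    and g: "((\<lambda>z. frechet_derivative f (at z) a) has_derivative g') (at x)"
    and k: "((\<lambda>z. frechet_derivative f (at z) b) has_derivative k') (at x)"
  shows "g' b = k' a"
proof -
  obtain r where r: "r > 0" "ball x r \<subseteq> S" using assms(1,2) open_contains_ball by blast
  have "\<bar>g' b - k' a\<bar> \<le> 2 * e" if e: "e > 0" for e
  proof -
    obtain d1 where d1: "d1 > 0" "\<forall>h. 0 < h \<and> h < d1 \<longrightarrow>
        \<bar>f (x + h *\<^sub>R a + h *\<^sub>R b) - f (x + h *\<^sub>R a) - f (x + h *\<^sub>R b) + f x - h\<^sup>2 * g' b\<bar> \<le> e * h\<^sup>2"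
      using second_difference_estimate[OF r(1) _ g e] f r(2) by blast
    obtain d2 where d2: "d2 > 0" "\<forall>h. 0 < h \<and> h < d2 \<longrightarrow>
        \<bar>f (x + h *\<^sub>R b + h *\<^sub>R a) - f (x + h *\<^sub>R b) - f (x + h *\<^sub>R a) + f x - h\<^sup>2 * k' a\<bar> \<le> e * h\<^sup>2"
      using second_difference_estimate[OF r(1) _ k e] f r(2) by blast
    define h where "h = min d1 d2 / 2"
    have h: "0 < h" "h < d1" "h < d2" using d1(1) d2(1) by (auto simp: h_def)
    have swap: "x + h *\<^sub>R b + h *\<^sub>R a = x + h *\<^sub>R a + h *\<^sub>R b" by (simp add: algebra_simps)
    have "\<bar>h\<^sup>2 * g' b - h\<^sup>2 * k' a\<bar> \<le> 2 * (e * h\<^sup>2)"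
      using d1(2)[rule_format, of h] d2(2)[rule_format, of h] h
      unfolding swap by (simp add: abs_le_iff)
    then have "h\<^sup>2 * \<bar>g' b - k' a\<bar> \<le> h\<^sup>2 * (2 * e)"
      by (simp add: abs_mult flip: right_diff_distrib) (simp add: mult_ac)
    then show ?thesis using h by simp
  qed
  from this[of "\<bar>g' b - k' a\<bar> / 4"] show ?thesis by (cases "g' b = k' a") auto
qed

section \<open>Smooth functions\<close>

lemma C_diff_cong:
  assumes "open S" and "\<And>z. z \<in> S \<Longrightarrow> f z = g z"
  shows "C_diff k S f \<longleftrightarrow> C_diff k S g"
  using assms(2)
proof (induction k arbitrary: f g)
  case 0
  then show ?case by (auto cong: continuous_on_cong)
next
  case (Suc k)
  have d: "f differentiable (at z) \<longleftrightarrow> g differentiable (at z)" if "z \<in> S" for z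
    using has_derivative_transform_within_open[OF _ assms(1) that] Suc.prems
    unfolding differentiable_def by metis
  have "frechet_derivative f (at z) = frechet_derivative g (at z)" if "z \<in> S" for z
  proof -
    have "(f has_derivative D) (at z) \<longleftrightarrow> (g has_derivative D) (at z)" for D
      using has_derivative_transform_within_open[OF _ assms(1) that] Suc.prems by metis
    then show ?thesis by (simp add: frechet_derivative_def)
  qed
  then have "C_diff k S (\<lambda>z. frechet_derivative f (at z) (axis i 1)) \<longleftrightarrow>
      C_diff k S (\<lambda>z. frechet_derivative g (at z) (axis i 1))" for i
    by (intro Suc.IH) simp
  then show ?case using d by simp
qed

lemma C_diff_SucD: "C_diff (Suc k) S f \<Longrightarrow> C_diff k S f"
proof (induction k arbitrary: f)
  case 0
  then show ?case
    by (auto intro!: continuous_at_imp_continuous_on differentiable_imp_continuous_within)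
next
  case (Suc k)
  have "C_diff k S (\<lambda>z. frechet_derivative f (at z) (axis i 1))" for i
    using Suc.prems unfolding C_diff.simps(2)[of "Suc k"] by (intro Suc.IH) simp
  then show ?case
    using Suc.prems unfolding C_diff.simps(2)[of "Suc k"] C_diff.simps(2)[of k S f] by simp
qed

lemma C_diff_const: "C_diff k S (\<lambda>z. a)"
  by (induction k arbitrary: a) auto

lemma C_diff_add:
  assumes "open S"
  shows "C_diff k S f \<Longrightarrow> C_diff k S g \<Longrightarrow> C_diff k S (\<lambda>z. f z + g z)"
proof (induction k arbitrary: f g)
  case 0
  then show ?case by (simp add: continuous_on_add)
next
  case (Suc k)
  have "C_diff k S (\<lambda>z. frechet_derivative f (at z) (axis i 1) + frechet_derivative g (at z) (axis i 1))" for i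
    using Suc by simp
  moreover have "frechet_derivative (\<lambda>z. f z + g z) (at z) =
      (\<lambda>h. frechet_derivative f (at z) h + frechet_derivative g (at z) h)" if "z \<in> S" for z
    using Suc.prems that frechet_derivative_works
    by (intro frechet_derivative_at[symmetric] has_derivative_add) auto
  ultimately have "C_diff k S (\<lambda>z. frechet_derivative (\<lambda>z. f z + g z) (at z) (axis i 1))" for i
    by (subst C_diff_cong[OF assms, of _ "\<lambda>z. frechet_derivative f (at z) (axis i 1) + frechet_derivative g (at z) (axis i 1)"]) auto
  then show ?case using Suc.prems by auto
qed

lemma C_diff_mult:
  assumes "open S"
  shows "C_diff k S f \<Longrightarrow> C_diff k S g \<Longrightarrow> C_diff k S (\<lambda>z. f z * g z)"
proof (induction k arbitrary: f g)
  case 0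
  then show ?case by (simp add: continuous_on_mult)
next
  case (Suc k)
  let ?D = "\<lambda>i z. f z * frechet_derivative g (at z) (axis i 1) + frechet_derivative f (at z) (axis i 1) * g z"
  have "C_diff k S f" "C_diff k S g" using Suc.prems C_diff_SucD by blast+
  then have "C_diff k S (?D i)" for i
    using Suc by (intro C_diff_add[OF assms] Suc.IH) auto
  moreover have "frechet_derivative (\<lambda>z. f z * g z) (at z) =
      (\<lambda>h. f z * frechet_derivative g (at z) h + frechet_derivative f (at z) h * g z)" if "z \<in> S" for z
    using Suc.prems that frechet_derivative_works
    by (intro frechet_derivative_at[symmetric] has_derivative_mult) auto
  ultimately have "C_diff k S (\<lambda>z. frechet_derivative (\<lambda>z. f z * g z) (at z) (axis i 1))" for i
    by (subst C_diff_cong[OF assms, of _ "?D i"]) auto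
  then show ?case using Suc.prems by auto
qed

lemma C_inf_cong:
  assumes "open S" and "\<And>z. z \<in> S \<Longrightarrow> f z = g z"
  shows "C_inf S f \<longleftrightarrow> C_inf S g"
  using C_diff_cong[OF assms] by (simp add: C_inf_def)

lemma C_inf_const: "C_inf S (\<lambda>z. a)"
  by (simp add: C_inf_def C_diff_const)

lemma C_inf_add: "open S \<Longrightarrow> C_inf S f \<Longrightarrow> C_inf S g \<Longrightarrow> C_inf S (\<lambda>z. f z + g z)"
  by (simp add: C_inf_def C_diff_add)

lemma C_inf_mult: "open S \<Longrightarrow> C_inf S f \<Longrightarrow> C_inf S g \<Longrightarrow> C_inf S (\<lambda>z. f z * g z)"
  by (simp add: C_inf_def C_diff_mult)

lemma C_inf_imp_differentiable: "C_inf S f \<Longrightarrow> z \<in> S \<Longrightarrow> f differentiable (at z)"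
  unfolding C_inf_def by (metis C_diff.simps(2))

lemma C_inf_partial: "C_inf S f \<Longrightarrow> C_inf S (\<lambda>z. frechet_derivative f (at z) (axis i 1))"
  unfolding C_inf_def by (metis C_diff.simps(2))

section \<open>Calculus in the charts of a manifold\<close>

text \<open>Differentiability at a single point, read in a chart; by the chain rule below the
  choice of the chart does not matter.\<close>

definition diff_at :: "('c,'m,'n::finite) manifold \<Rightarrow> 'c \<Rightarrow> ('m \<Rightarrow> real) \<Rightarrow> 'm \<Rightarrow> bool" where
  "diff_at M c f x \<longleftrightarrow> (f \<circ> inv_into (cdom M c) (xc M c)) differentiable (at (xc M c x))"

locale smooth_atlas =
  fixes M :: "('c, 'm::{t2_space, second_countable_topology}, 'n::finite) manifold"
  assumes smooth_manifold: "smooth_manifold M"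
begin

definition in_chart :: "'c \<Rightarrow> 'm \<Rightarrow> bool" where
  "in_chart c x \<longleftrightarrow> c \<in> charts M \<and> x \<in> cdom M c"

abbreviation param :: "'c \<Rightarrow> real^'n \<Rightarrow> 'm" where
  "param c \<equiv> inv_into (cdom M c) (xc M c)"

lemma open_cdom: "c \<in> charts M \<Longrightarrow> open (cdom M c)"
  using smooth_manifold by (simp add: smooth_manifold_def)

lemma chart_homeomorphism:
  "c \<in> charts M \<Longrightarrow> homeomorphism (cdom M c) (xc M c ` cdom M c) (xc M c) (param c)"
  using smooth_manifold by (simp add: smooth_manifold_def)

lemma param_xc: "in_chart c x \<Longrightarrow> param c (xc M c x) = x"
  using chart_homeomorphism by (simp add: in_chart_def homeomorphism_def)

lemma open_xc_image:
  assumes "c \<in> charts M" "open U" "U \<subseteq> cdom M c"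
  shows "open (xc M c ` U)"
proof -
  have "openin (top_of_set (xc M c ` cdom M c)) (xc M c ` U)"
    using homeomorphism_imp_open_map[OF chart_homeomorphism[OF assms(1)], of U] assms
    by (simp add: open_subset)
  moreover have "open (xc M c ` cdom M c)"
    using smooth_manifold assms(1) by (simp add: smooth_manifold_def)
  ultimately show ?thesis using openin_open_trans by blast
qed

lemma open_xc_cdom: "c \<in> charts M \<Longrightarrow> open (xc M c ` cdom M c)"
  by (simp add: open_xc_image open_cdom)

lemma derivative_param_cong:
  assumes "in_chart c x" "open U" "x \<in> U" and eq: "\<And>y. y \<in> U \<Longrightarrow> in_chart c y \<Longrightarrow> f y = g y"
  shows "((f \<circ> param c) has_derivative D) (at (xc M c x)) \<longleftrightarrow> ((g \<circ> param c) has_derivative D) (at (xc M c x))"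
proof -
  let ?V = "xc M c ` (U \<inter> cdom M c)"
  have "open ?V" "xc M c x \<in> ?V"
    using assms open_cdom by (auto intro!: open_xc_image simp: in_chart_def)
  moreover have "(f \<circ> param c) z = (g \<circ> param c) z" if "z \<in> ?V" for z
    using that eq assms(1) by (auto simp: param_xc in_chart_def)
  ultimately show ?thesis
    using has_derivative_transform_within_open[of _ D "xc M c x" UNIV ?V] by metis
qed

lemma pd_cong:
  assumes "in_chart c x" "open U" "x \<in> U" and "\<And>y. y \<in> U \<Longrightarrow> in_chart c y \<Longrightarrow> f y = g y"
  shows "pd M c l f x = pd M c l g x"
  using derivative_param_cong[OF assms] by (simp add: pd_def frechet_derivative_def)

lemma diff_at_cong:
  assumes "in_chart c x" "open U" "x \<in> U" and "\<And>y. y \<in> U \<Longrightarrow> in_chart c y \<Longrightarrow> f y = g y"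
  shows "diff_at M c f x \<longleftrightarrow> diff_at M c g x"
  using derivative_param_cong[OF assms] by (simp add: diff_at_def differentiable_def)

lemma diff_at_works:
  "diff_at M c f x \<Longrightarrow>
    ((f \<circ> param c) has_derivative frechet_derivative (f \<circ> param c) (at (xc M c x))) (at (xc M c x))"
  by (simp add: diff_at_def frechet_derivative_works)

lemma has_derivative_imp_pd:
  assumes "((f \<circ> param c) has_derivative D) (at (xc M c x))"
  shows "diff_at M c f x" and "pd M c l f x = D (axis l 1)"
  using assms frechet_derivative_at[OF assms] by (auto simp: diff_at_def pd_def differentiable_def)

lemma diff_at_const: "diff_at M c (\<lambda>y. a) x" and pd_const: "pd M c l (\<lambda>y. a) x = 0"
  by (simp_all add: diff_at_def pd_def o_def)

lemma
  assumes "diff_at M c f x" "diff_at M c g x"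
  shows diff_at_add: "diff_at M c (\<lambda>y. f y + g y) x"
    and pd_add: "pd M c l (\<lambda>y. f y + g y) x = pd M c l f x + pd M c l g x"
proof -
  have "(((\<lambda>y. f y + g y) \<circ> param c) has_derivative
      (\<lambda>h. frechet_derivative (f \<circ> param c) (at (xc M c x)) h
         + frechet_derivative (g \<circ> param c) (at (xc M c x)) h)) (at (xc M c x))"
    using has_derivative_add[OF assms[THEN diff_at_works]] by (simp add: o_def)
  note has_derivative_imp_pd[OF this]
  then show "diff_at M c (\<lambda>y. f y + g y) x"
    "pd M c l (\<lambda>y. f y + g y) x = pd M c l f x + pd M c l g x"
    by (simp_all add: pd_def)
qed

lemma
  assumes "diff_at M c f x" "diff_at M c g x"
  shows diff_at_mult: "diff_at M c (\<lambda>y. f y * g y) x"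
    and pd_mult: "in_chart c x \<Longrightarrow> pd M c l (\<lambda>y. f y * g y) x = pd M c l f x * g x + f x * pd M c l g x"
proof -
  have "(((\<lambda>y. f y * g y) \<circ> param c) has_derivative
      (\<lambda>h. (f \<circ> param c) (xc M c x) * frechet_derivative (g \<circ> param c) (at (xc M c x)) h
         + frechet_derivative (f \<circ> param c) (at (xc M c x)) h * (g \<circ> param c) (xc M c x))) (at (xc M c x))"
    using has_derivative_mult[OF assms[THEN diff_at_works]] by (simp add: o_def)
  note has_derivative_imp_pd[OF this]
  then show "diff_at M c (\<lambda>y. f y * g y) x"
    "in_chart c x \<Longrightarrow> pd M c l (\<lambda>y. f y * g y) x = pd M c l f x * g x + f x * pd M c l g x"
    by (simp_all add: pd_def param_xc)
qed

lemma
  assumes "finite I" "\<And>i. i \<in> I \<Longrightarrow> diff_at M c (f i) x"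
  shows diff_at_sum: "diff_at M c (\<lambda>y. \<Sum>i\<in>I. f i y) x"
    and pd_sum: "pd M c l (\<lambda>y. \<Sum>i\<in>I. f i y) x = (\<Sum>i\<in>I. pd M c l (f i) x)"
proof -
  have "diff_at M c (\<lambda>y. \<Sum>i\<in>I. f i y) x \<and> pd M c l (\<lambda>y. \<Sum>i\<in>I. f i y) x = (\<Sum>i\<in>I. pd M c l (f i) x)"
    using assms by (induction I) (simp_all add: diff_at_const pd_const diff_at_add pd_add)
  then show "diff_at M c (\<lambda>y. \<Sum>i\<in>I. f i y) x"
    "pd M c l (\<lambda>y. \<Sum>i\<in>I. f i y) x = (\<Sum>i\<in>I. pd M c l (f i) x)" by auto
qed

lemma pd_diff:
  assumes "diff_at M c f x" "diff_at M c g x" "in_chart c x"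
  shows "pd M c l (\<lambda>y. f y - g y) x = pd M c l f x - pd M c l g x"
proof -
  have m: "diff_at M c (\<lambda>y. - 1 * g y) x" "pd M c l (\<lambda>y. - 1 * g y) x = - pd M c l g x"
    using diff_at_mult[OF diff_at_const[of c "-1" x] assms(2)]
      pd_mult[OF diff_at_const[of c "-1" x] assms(2,3), of l] by (simp_all add: pd_const)
  show ?thesis using pd_add[OF assms(1) m(1), of l] m(2) by simp
qed

lemma smooth_in_imp_diff_at:
  "smooth_in M c U f \<Longrightarrow> x \<in> U \<Longrightarrow> diff_at M c f x"
  by (simp add: smooth_in_def diff_at_def C_inf_imp_differentiable)

lemma smooth_in_const: "smooth_in M c U (\<lambda>y. a)"
  by (simp add: smooth_in_def o_def C_inf_const)

lemma
  assumes "c \<in> charts M" "smooth_in M c (cdom M c) f" "smooth_in M c (cdom M c) g"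
  shows smooth_in_add: "smooth_in M c (cdom M c) (\<lambda>y. f y + g y)"
    and smooth_in_mult: "smooth_in M c (cdom M c) (\<lambda>y. f y * g y)"
  using assms C_inf_add C_inf_mult open_xc_cdom[OF assms(1)]
  by (simp_all add: smooth_in_def o_def)

lemma smooth_in_sum:
  assumes "c \<in> charts M" "finite I" "\<And>i. i \<in> I \<Longrightarrow> smooth_in M c (cdom M c) (f i)"
  shows "smooth_in M c (cdom M c) (\<lambda>y. \<Sum>i\<in>I. f i y)"
  using assms(2,3) by (induction I) (simp_all add: smooth_in_const smooth_in_add[OF assms(1)])

lemma smooth_in_diff:
  assumes "c \<in> charts M" "smooth_in M c (cdom M c) f" "smooth_in M c (cdom M c) g"
  shows "smooth_in M c (cdom M c) (\<lambda>y. f y - g y)"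
  using smooth_in_add[OF assms(1,2) smooth_in_mult[OF assms(1) smooth_in_const[of c _ "-1"] assms(3)]]
  by simp

lemma smooth_in_cong:
  assumes "c \<in> charts M" "open U" "U \<subseteq> cdom M c" "\<And>y. y \<in> U \<Longrightarrow> f y = g y"
  shows "smooth_in M c U f \<longleftrightarrow> smooth_in M c U g"
  unfolding smooth_in_def
proof (rule C_inf_cong)
  show "open (xc M c ` U)" using assms by (intro open_xc_image)
  show "(f \<circ> param c) z = (g \<circ> param c) z" if "z \<in> xc M c ` U" for z
    using that assms by (auto simp: param_xc in_chart_def subset_iff)
qed

lemma smooth_in_pd:
  assumes "c \<in> charts M" "open U" "U \<subseteq> cdom M c" and f: "smooth_in M c U f"
  shows "smooth_in M c U (pd M c l f)"
proof -
  have eq: "(pd M c l f \<circ> param c) z = frechet_derivative (f \<circ> param c) (at z) (axis l 1)"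
    if z: "z \<in> xc M c ` U" for z
  proof -
    obtain y where y: "y \<in> U" "z = xc M c y" using z by blast
    then have "in_chart c y" using assms(1,3) by (auto simp: in_chart_def)
    then show ?thesis by (simp add: pd_def y(2) param_xc)
  qed
  have "C_inf (xc M c ` U) (pd M c l f \<circ> param c) \<longleftrightarrow>
      C_inf (xc M c ` U) (\<lambda>z. frechet_derivative (f \<circ> param c) (at z) (axis l 1))"
    by (rule C_inf_cong[OF open_xc_image[OF assms(1-3)] eq])
  then show ?thesis using C_inf_partial f unfolding smooth_in_def by blast
qed

lemma pd_commute:
  assumes "in_chart c x" and f: "smooth_in M c (cdom M c) f"
  shows "pd M c m (pd M c l f) x = pd M c l (pd M c m f) x"
proof -
  let ?f = "f \<circ> param c" and ?S = "xc M c ` cdom M c"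
  have c: "c \<in> charts M" "x \<in> cdom M c" using assms(1) by (auto simp: in_chart_def)
  have inv: "xc M c (param c z) = z" if "z \<in> ?S" for z
    using that c by (auto simp: param_xc in_chart_def)
  have S: "open ?S" "xc M c x \<in> ?S" using open_xc_cdom[OF c(1)] c by auto
  have D: "((\<lambda>z. frechet_derivative ?f (at z) (axis k 1)) has_derivative
      frechet_derivative (pd M c k f \<circ> param c) (at (xc M c x))) (at (xc M c x))" for k
  proof (rule has_derivative_transform_within_open[OF _ S])
    show "((pd M c k f \<circ> param c) has_derivative
        frechet_derivative (pd M c k f \<circ> param c) (at (xc M c x))) (at (xc M c x))"
      using smooth_in_pd[OF c(1) open_cdom[OF c(1)] order_refl f]
      by (intro diff_at_works smooth_in_imp_diff_at[OF _ c(2)])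
  qed (simp add: pd_def inv)
  have "?f differentiable (at z)" if "z \<in> ?S" for z
    using f C_inf_imp_differentiable that by (simp add: smooth_in_def)
  from second_derivative_symmetric[OF S this D D] show ?thesis by (simp add: pd_def)
qed

lemma diff_at_coordinate:
  assumes "in_chart c x" "in_chart d x"
  shows "diff_at M c (\<lambda>y. xc M d y $ m) x"
proof (rule smooth_in_imp_diff_at)
  show "smooth_in M c (cdom M c \<inter> cdom M d) (\<lambda>y. xc M d y $ m)"
    using smooth_manifold assms by (simp add: smooth_manifold_def in_chart_def)
qed (use assms in \<open>simp add: in_chart_def\<close>)

lemma pd_coordinate_self:
  assumes "in_chart c x"
  shows "pd M c l (\<lambda>y. xc M c y $ m) x = (if l = m then 1 else 0)"
proof -
  let ?S = "xc M c ` cdom M c"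
  have S: "open ?S" "xc M c x \<in> ?S" using open_xc_cdom assms by (auto simp: in_chart_def)
  have "((\<lambda>z. z $ m) has_derivative (\<lambda>h. h $ m)) (at (xc M c x))"
    by (rule bounded_linear_imp_has_derivative[OF bounded_linear_vec_nth])
  then have "(((\<lambda>y. xc M c y $ m) \<circ> param c) has_derivative (\<lambda>h. h $ m)) (at (xc M c x))"
    by (rule has_derivative_transform_within_open[OF _ S])
      (use assms in \<open>auto simp: param_xc in_chart_def\<close>)
  from has_derivative_imp_pd(2)[OF this] show ?thesis by (auto simp: axis_def)
qed

lemma
  assumes c: "in_chart c x" and d: "in_chart d x" and f: "diff_at M d f x"
  shows diff_at_change_chart: "diff_at M c f x"
    and pd_chain: "pd M c l f x = (\<Sum>m\<in>UNIV. pd M c l (\<lambda>y. xc M d y $ m) x * pd M d m f x)"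
proof -
  let ?f = "f \<circ> param d" and ?f' = "frechet_derivative (f \<circ> param d) (at (xc M d x))"
  let ?X = "\<lambda>m h. frechet_derivative ((\<lambda>y. xc M d y $ m) \<circ> param c) (at (xc M c x)) h"
  let ?V = "xc M c ` (cdom M c \<inter> cdom M d)"
  have V: "open ?V" "xc M c x \<in> ?V"
    using c d open_cdom by (auto intro!: open_xc_image simp: in_chart_def)
  \<comment> \<open>The coordinate change from c to d is differentiable because its components are.\<close>
  have "((\<lambda>z. (((\<lambda>y. xc M d y $ m) \<circ> param c) z) *\<^sub>R axis m (1::real)) has_derivative
      (\<lambda>h. ?X m h *\<^sub>R axis m 1)) (at (xc M c x))" for m
    by (rule has_derivative_scaleR_left[OF diff_at_works[OF diff_at_coordinate[OF c d]]])
  then have "((\<lambda>z. \<Sum>m\<in>UNIV. (((\<lambda>y. xc M d y $ m) \<circ> param c) z) *\<^sub>R axis m 1) has_derivative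
      (\<lambda>h. \<Sum>m\<in>UNIV. ?X m h *\<^sub>R axis m (1::real))) (at (xc M c x))"
    by (rule has_derivative_sum)
  moreover have "(\<lambda>z. \<Sum>m\<in>UNIV. (((\<lambda>y. xc M d y $ m) \<circ> param c) z) *\<^sub>R axis m 1) = xc M d \<circ> param c"
    using basis_expansion[where 'a=real and 'n='n] by (auto simp: scalar_mult_eq_scaleR)
  ultimately have X: "((xc M d \<circ> param c) has_derivative (\<lambda>h. \<Sum>m\<in>UNIV. ?X m h *\<^sub>R axis m 1)) (at (xc M c x))"
    by simp
  have f': "(?f has_derivative ?f') (at ((xc M d \<circ> param c) (xc M c x)))"
    using diff_at_works[OF f] by (simp add: param_xc c)
  have "((?f \<circ> (xc M d \<circ> param c)) has_derivative ?f' \<circ> (\<lambda>h. \<Sum>m\<in>UNIV. ?X m h *\<^sub>R axis m 1)) (at (xc M c x))"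
    by (rule diff_chain_at[OF X f'])
  moreover have "?f' (\<Sum>m\<in>UNIV. ?X m h *\<^sub>R axis m 1) = (\<Sum>m\<in>UNIV. ?X m h * ?f' (axis m 1))" for h
    using has_derivative_linear[OF f'] by (simp add: linear_sum linear_cmul)
  ultimately have "((?f \<circ> (xc M d \<circ> param c)) has_derivative (\<lambda>h. \<Sum>m\<in>UNIV. ?X m h * ?f' (axis m 1))) (at (xc M c x))"
    by (simp add: o_def)
  then have "((f \<circ> param c) has_derivative (\<lambda>h. \<Sum>m\<in>UNIV. ?X m h * ?f' (axis m 1))) (at (xc M c x))"
    by (rule has_derivative_transform_within_open[OF _ V])
      (use c d in \<open>auto simp: param_xc in_chart_def\<close>)
  from has_derivative_imp_pd[OF this] show "diff_at M c f x"
    "pd M c l f x = (\<Sum>m\<in>UNIV. pd M c l (\<lambda>y. xc M d y $ m) x * pd M d m f x)"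
    by (auto simp: pd_def)
qed

text \<open>A vector bundle whose transition matrices are only required to be differentiable. For tangent, dual and
  product bundles this is much easier to obtain than smoothness of the transition matrices: the matrix of a dual bundle is known
  to be smooth in the other chart, and differentiability at a point is carried from chart to chart by the chain
  rule for first derivatives.\<close>

definition diff_bundle :: "('c, 'm, 'n, 'v) vbundle \<Rightarrow> bool" where
  "diff_bundle F \<longleftrightarrow> finite (fidx F) \<and>
     (\<forall>x. \<forall>u\<in>fib F x. \<forall>v\<in>fib F x. vadd F x u v \<in> fib F x) \<and>
     (\<forall>x a. \<forall>v\<in>fib F x. vscale F x a v \<in> fib F x) \<and>
     (\<forall>c x. in_chart c x \<longrightarrow>
        bij_betw (crd F c x) (fib F x) {f. \<forall>i. i \<notin> fidx F \<longrightarrow> f i = 0} \<and>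
        (\<forall>u\<in>fib F x. \<forall>v\<in>fib F x. \<forall>i.
           crd F c x (vadd F x u v) i = crd F c x u i + crd F c x v i) \<and>
        (\<forall>a. \<forall>v\<in>fib F x. \<forall>i. crd F c x (vscale F x a v) i = a * crd F c x v i)) \<and>
     (\<forall>c d x. in_chart c x \<longrightarrow> in_chart d x \<longrightarrow> (\<forall>i\<in>fidx F. \<forall>j\<in>fidx F.
        diff_at M c (\<lambda>y. trans_fn F c d y i j) x))"

lemma vector_bundle_imp_diff_bundle:
  assumes "vector_bundle M F"
  shows "diff_bundle F"
proof -
  have "diff_at M c (\<lambda>y. trans_fn F c d y i j) x"
    if "in_chart c x" "in_chart d x" "i \<in> fidx F" "j \<in> fidx F" for c d x i j
    using that assms
    by (intro smooth_in_imp_diff_at[of c "cdom M c \<inter> cdom M d"])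
      (auto simp: in_chart_def vector_bundle_def)
  then show ?thesis using assms by (simp add: vector_bundle_def diff_bundle_def in_chart_def)
qed

text \<open>The conditions on a family of matrices under which \<open>assoc_bundle\<close> glues local products to a bundle with
  exactly these transition matrices.\<close>

definition diff_cocycle ::
  "'n idx set \<Rightarrow> ('c \<Rightarrow> 'c \<Rightarrow> 'm \<Rightarrow> 'n idx \<Rightarrow> 'n idx \<Rightarrow> real) \<Rightarrow> bool" where
  "diff_cocycle I G \<longleftrightarrow> finite I \<and>
     (\<forall>c x. in_chart c x \<longrightarrow> (\<forall>i\<in>I. \<forall>k\<in>I. G c c x i k = (if i = k then 1 else 0))) \<and>
     (\<forall>c d e x. in_chart c x \<longrightarrow> in_chart d x \<longrightarrow> in_chart e x \<longrightarrow>
        (\<forall>i\<in>I. \<forall>k\<in>I. (\<Sum>j\<in>I. G c d x i j * G d e x j k) = G c e x i k)) \<and>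
     (\<forall>c d x. in_chart c x \<longrightarrow> in_chart d x \<longrightarrow> (\<forall>i\<in>I. \<forall>j\<in>I. diff_at M c (\<lambda>y. G c d y i j) x))"

context
  fixes F :: "('c, 'm, 'n, 'v) vbundle" and x :: 'm
  assumes F: "diff_bundle F"
begin

lemma finite_fidx: "finite (fidx F)"
  using F by (simp add: diff_bundle_def)

context
  fixes d :: 'c
  assumes d: "in_chart d x"
begin

lemma crd_bij: "bij_betw (crd F d x) (fib F x) {f. \<forall>i. i \<notin> fidx F \<longrightarrow> f i = 0}"
  using F d by (simp add: diff_bundle_def)

lemma crd_inject: "u \<in> fib F x \<Longrightarrow> v \<in> fib F x \<Longrightarrow> crd F d x u = crd F d x v \<longleftrightarrow> u = v"
  using crd_bij by (meson bij_betw_imp_inj_on inj_on_eq_iff)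

lemma crd_surjective:
  assumes "\<And>i. i \<notin> fidx F \<Longrightarrow> f i = 0"
  obtains v where "v \<in> fib F x" "crd F d x v = f"
proof -
  have "f \<in> crd F d x ` fib F x" using crd_bij assms by (simp add: bij_betw_def)
  then show ?thesis using that by auto
qed

lemma crd_outside: "v \<in> fib F x \<Longrightarrow> i \<notin> fidx F \<Longrightarrow> crd F d x v i = 0"
  using bij_betw_apply[OF crd_bij] by blast

lemma
  assumes "j \<in> fidx F"
  shows frame_in_fib: "frame F d x j \<in> fib F x"
    and crd_frame: "crd F d x (frame F d x j) i = (if i = j then 1 else 0)"
proof -
  obtain v where v: "v \<in> fib F x" "crd F d x v = (\<lambda>i. if i = j then 1 else 0)"
    using crd_surjective[of "\<lambda>i. if i = j then 1 else 0"] assms by metis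
  then have "frame F d x j = v"
    unfolding frame_def by (intro the_equality) (auto simp flip: crd_inject)
  with v show "frame F d x j \<in> fib F x"
    "crd F d x (frame F d x j) i = (if i = j then 1 else 0)" by auto
qed

text \<open>The one consequence of linearity that is needed: applied to a fibre coordinate of another chart it gives the
  transition law, applied to a jet coordinate of a connection it gives the action of the coefficients.\<close>

lemma linear_frame_expansion:
  assumes add: "\<And>u v. u \<in> fib F x \<Longrightarrow> v \<in> fib F x \<Longrightarrow> L (vadd F x u v) = L u + (L v :: real)"
    and scale: "\<And>a v. v \<in> fib F x \<Longrightarrow> L (vscale F x a v) = a * L v"
    and v: "v \<in> fib F x"
  shows "L v = (\<Sum>j\<in>fidx F. L (frame F d x j) * crd F d x v j)"
proof -
  have closed: "u \<in> fib F x \<Longrightarrow> w \<in> fib F x \<Longrightarrow> vadd F x u w \<in> fib F x"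
      "u \<in> fib F x \<Longrightarrow> vscale F x a u \<in> fib F x" for u w a
    using F by (auto simp: diff_bundle_def)
  have crd: "u \<in> fib F x \<Longrightarrow> w \<in> fib F x \<Longrightarrow> crd F d x (vadd F x u w) i = crd F d x u i + crd F d x w i"
      "u \<in> fib F x \<Longrightarrow> crd F d x (vscale F x a u) i = a * crd F d x u i" for u w a i
    using F d by (auto simp: diff_bundle_def)
  let ?f = "crd F d x v"
  \<comment> \<open>Partial sums of the expansion of v, built up one frame vector at a time.\<close>
  have "\<exists>w\<in>fib F x. crd F d x w = (\<lambda>j. if j \<in> J then ?f j else 0) \<and>
      L w = (\<Sum>j\<in>J. L (frame F d x j) * ?f j)" if "finite J" "J \<subseteq> fidx F" for J
    using that
  proof (induction J)
    case empty
    have "crd F d x (vscale F x 0 v) = (\<lambda>j. 0)" using v by (auto simp: crd)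
    then show ?case using v closed scale[OF v, of 0] by (intro bexI[of _ "vscale F x 0 v"]) auto
  next
    case (insert k J)
    then obtain w where w: "w \<in> fib F x" "crd F d x w = (\<lambda>j. if j \<in> J then ?f j else 0)"
      "L w = (\<Sum>j\<in>J. L (frame F d x j) * ?f j)" by auto
    let ?e = "frame F d x k"
    have e: "?e \<in> fib F x" using insert.prems by (simp add: frame_in_fib)
    show ?case
    proof (intro bexI[of _ "vadd F x w (vscale F x (?f k) ?e)"] conjI)
      show "crd F d x (vadd F x w (vscale F x (?f k) ?e)) = (\<lambda>j. if j \<in> insert k J then ?f j else 0)"
        using insert w e by (auto simp: crd closed crd_frame)
      show "L (vadd F x w (vscale F x (?f k) ?e)) = (\<Sum>j\<in>insert k J. L (frame F d x j) * ?f j)"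
        using insert.hyps w e by (simp add: add scale closed)
    qed (use w e closed in auto)
  qed
  from this[OF finite_fidx] obtain w where w: "w \<in> fib F x"
    "crd F d x w = (\<lambda>j. if j \<in> fidx F then ?f j else 0)"
    "L w = (\<Sum>j\<in>fidx F. L (frame F d x j) * ?f j)" by auto
  moreover have "crd F d x w = ?f" using w(2) crd_outside[OF v] by auto
  ultimately show ?thesis using v crd_inject by metis
qed

lemma crd_change_chart:
  assumes "in_chart c x" "v \<in> fib F x"
  shows "crd F c x v i = (\<Sum>j\<in>fidx F. trans_fn F c d x i j * crd F d x v j)"
  unfolding trans_fn_def
  using F assms by (intro linear_frame_expansion[of "\<lambda>v. crd F c x v i"]) (auto simp: diff_bundle_def)

end

end

lemma diff_bundle_cocycle:
  assumes F: "diff_bundle F"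
  shows "diff_cocycle (fidx F) (trans_fn F)"
  unfolding diff_cocycle_def
proof (intro conjI allI impI ballI)
  fix c d e x i k assume "in_chart c x" "in_chart d x" "in_chart e x" "i \<in> fidx F" "k \<in> fidx F"
  then show "(\<Sum>j\<in>fidx F. trans_fn F c d x i j * trans_fn F d e x j k) = trans_fn F c e x i k"
    using crd_change_chart[OF F, of d x c "frame F e x k" i] frame_in_fib[OF F]
    by (simp add: trans_fn_def)
qed (use F in \<open>auto simp: diff_bundle_def trans_fn_def crd_frame[OF F]\<close>)

lemma assoc_bundle_fib:
  "w \<in> fib (assoc_bundle M I G) x \<longleftrightarrow> (\<forall>c i. \<not> in_chart c x \<or> i \<notin> I \<longrightarrow> w c i = 0) \<and>
    (\<forall>c d. in_chart c x \<longrightarrow> in_chart d x \<longrightarrow> (\<forall>i\<in>I. w c i = (\<Sum>j\<in>I. G c d x i j * w d j)))"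
  unfolding assoc_bundle_def in_chart_def vbundle.simps mem_Collect_eq Int_iff by blast

text \<open>The cocycle identities make the array of a vector in one chart determine those in all others
  consistently, so every array of one chart is that of a unique vector; the frame vectors then show
  that G is recovered as the family of transition matrices.\<close>

lemma
  assumes G: "diff_cocycle I G"
  shows assoc_bundle_diff_bundle: "diff_bundle (assoc_bundle M I G)"
    and assoc_bundle_trans_fn: "in_chart c x \<Longrightarrow> in_chart d x \<Longrightarrow> i \<in> I \<Longrightarrow> j \<in> I \<Longrightarrow>
      trans_fn (assoc_bundle M I G) c d x i j = G c d x i j"
proof -
  let ?B = "assoc_bundle M I G"
  have fin: "finite I" using G by (simp add: diff_cocycle_def)
  note fib = assoc_bundle_fib[of _ I G]
  have bij: "bij_betw (crd ?B c x) (fib ?B x) {f. \<forall>i. i \<notin> I \<longrightarrow> f i = 0}" if c: "in_chart c x" for c x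
  proof -
    have "inj_on (crd ?B c x) (fib ?B x)"
    proof (rule inj_onI)
      fix u v assume u: "u \<in> fib ?B x" and v: "v \<in> fib ?B x" and "crd ?B c x u = crd ?B c x v"
      then have "u c = v c" by (simp add: assoc_bundle_def)
      then have "u e i = v e i" for e i
        using u v c unfolding fib by (cases "in_chart e x \<and> i \<in> I") auto
      then show "u = v" by auto
    qed
    moreover have "f \<in> crd ?B c x ` fib ?B x" if f: "\<forall>i. i \<notin> I \<longrightarrow> f i = 0" for f
    proof -
      \<comment> \<open>The array f in the chart c determines the arrays in all other charts.\<close>
      define w where "w = (\<lambda>e i. if in_chart e x \<and> i \<in> I then \<Sum>j\<in>I. G e c x i j * f j else 0)"
      have "(\<Sum>j\<in>I. G c c x i j * f j) = (\<Sum>j\<in>I. if j = i then f j else 0)" if "i \<in> I" for i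
        using G c that by (intro sum.cong) (auto simp: diff_cocycle_def)
      then have wc: "w c = f" using f c fin by (auto simp: w_def fun_eq_iff)
      have "(\<Sum>j\<in>I. G e c x i j * f j) = (\<Sum>j\<in>I. G e e' x i j * (\<Sum>k\<in>I. G e' c x j k * f k))"
        if "in_chart e x" "in_chart e' x" "i \<in> I" for e e' i
      proof -
        have "(\<Sum>j\<in>I. G e e' x i j * (\<Sum>k\<in>I. G e' c x j k * f k))
            = (\<Sum>k\<in>I. (\<Sum>j\<in>I. G e e' x i j * G e' c x j k) * f k)"
          unfolding sum_distrib_left sum_distrib_right by (subst sum.swap) (simp add: mult_ac)
        also have "\<dots> = (\<Sum>k\<in>I. G e c x i k * f k)"
          using G c that by (intro sum.cong) (auto simp: diff_cocycle_def)
        finally show ?thesis by simp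
      qed
      then have "w \<in> fib ?B x" unfolding fib w_def by auto
      then show ?thesis using wc by (force simp: assoc_bundle_def)
    qed
    moreover have "crd ?B c x w i = 0" if "w \<in> fib ?B x" "i \<notin> I" for w i
      using that unfolding fib by (simp add: assoc_bundle_def)
    ultimately show ?thesis unfolding bij_betw_def by blast
  qed
  have trans: "trans_fn ?B c d x i j = G c d x i j"
    if c: "in_chart c x" and d: "in_chart d x" and i: "i \<in> I" and j: "j \<in> I" for c d x i j
  proof -
    let ?\<delta> = "\<lambda>i. if i = j then 1 else (0::real)"
    have "?\<delta> \<in> crd ?B d x ` fib ?B x" using bij[OF d] j unfolding bij_betw_def by auto
    then obtain w where w: "w \<in> fib ?B x" "crd ?B d x w = ?\<delta>" by auto
    then have "frame ?B d x j = w"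
      unfolding frame_def using bij[OF d] 
      by (intro the_equality) (auto simp flip: inj_on_eq_iff[OF bij_betw_imp_inj_on[OF bij[OF d]]])
    moreover have "w c i = (\<Sum>k\<in>I. G c d x i k * w d k)" using w c d i unfolding fib by blast
    moreover have "w d = ?\<delta>" using w by (simp add: assoc_bundle_def)
    ultimately show ?thesis using fin j by (simp add: trans_fn_def assoc_bundle_def if_distrib cong: if_cong)
  qed
  show "in_chart c x \<Longrightarrow> in_chart d x \<Longrightarrow> i \<in> I \<Longrightarrow> j \<in> I \<Longrightarrow>
      trans_fn (assoc_bundle M I G) c d x i j = G c d x i j" by (rule trans)
  have ops: "fidx ?B = I" "vadd ?B = (\<lambda>x u v c i. u c i + v c i)"
    "vscale ?B = (\<lambda>x a v c i. a * v c i)" "crd ?B = (\<lambda>c x w. w c)" by (simp_all add: assoc_bundle_def)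
  have "(\<lambda>c i. u c i + v c i) \<in> fib ?B x" if "u \<in> fib ?B x" "v \<in> fib ?B x" for u v x
  proof -
    have "u c i + v c i = (\<Sum>j\<in>I. G c d x i j * (u d j + v d j))"
      if "in_chart c x" "in_chart d x" "i \<in> I" for c d i
    proof -
      have "u c i = (\<Sum>j\<in>I. G c d x i j * u d j)" "v c i = (\<Sum>j\<in>I. G c d x i j * v d j)"
        using that \<open>u \<in> fib ?B x\<close> \<open>v \<in> fib ?B x\<close> unfolding fib by blast+
      then show ?thesis by (simp add: distrib_left sum.distrib)
    qed
    moreover have "u c i + v c i = 0" if "\<not> in_chart c x \<or> i \<notin> I" for c i
      using that \<open>u \<in> fib ?B x\<close> \<open>v \<in> fib ?B x\<close> unfolding fib by (metis add_0)
    ultimately show ?thesis unfolding fib by blast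
  qed
  moreover have "(\<lambda>c i. a * v c i) \<in> fib ?B x" if "v \<in> fib ?B x" for v a x
  proof -
    have "a * v c i = (\<Sum>j\<in>I. G c d x i j * (a * v d j))"
      if "in_chart c x" "in_chart d x" "i \<in> I" for c d i
    proof -
      have "v c i = (\<Sum>j\<in>I. G c d x i j * v d j)"
        using that \<open>v \<in> fib ?B x\<close> unfolding fib by blast
      then show ?thesis by (simp add: sum_distrib_left mult.left_commute)
    qed
    moreover have "a * v c i = 0" if "\<not> in_chart c x \<or> i \<notin> I" for c i
      using that \<open>v \<in> fib ?B x\<close> unfolding fib by (metis mult_zero_right)
    ultimately show ?thesis unfolding fib by blast
  qed
  moreover have "diff_at M c (\<lambda>y. trans_fn ?B c d y i j) x"
    if c: "in_chart c x" and d: "in_chart d x" and i: "i \<in> I" and j: "j \<in> I" for c d x i j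
  proof -
    have "open (cdom M d)" "x \<in> cdom M d" using d open_cdom by (auto simp: in_chart_def)
    then have "diff_at M c (\<lambda>y. trans_fn ?B c d y i j) x \<longleftrightarrow> diff_at M c (\<lambda>y. G c d y i j) x"
      using d i j by (intro diff_at_cong[OF c]) (auto intro!: trans simp: in_chart_def)
    then show ?thesis using G c d i j by (simp add: diff_cocycle_def)
  qed
  ultimately show "diff_bundle ?B"
    using fin bij unfolding diff_bundle_def ops by auto
qed

section \<open>Trivial, tangent, dual and product bundles\<close>

lemma diff_cocycle_trivial: "diff_cocycle {Triv} (\<lambda>c d x i j. 1)"
  by (simp add: diff_cocycle_def diff_at_const)

text \<open>Transposition reverses products, and the exchange of the two charts restores their order.\<close>

lemma diff_cocycle_dual:
  assumes G: "diff_cocycle I G"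
  shows "diff_cocycle I (\<lambda>c d x i j. G d c x j i)"
  unfolding diff_cocycle_def
proof (intro conjI allI impI ballI)
  fix c d e x i k assume "in_chart c x" "in_chart d x" "in_chart e x" "i \<in> I" "k \<in> I"
  then have "(\<Sum>j\<in>I. G e d x k j * G d c x j i) = G e c x k i"
    using G unfolding diff_cocycle_def by blast
  then show "(\<Sum>j\<in>I. G d c x j i * G e d x k j) = G e c x k i"
    by (simp add: mult.commute)
qed (use G in \<open>auto simp: diff_cocycle_def intro: diff_at_change_chart\<close>)

lemma sum_Pair:
  "(\<Sum>k\<in>{Pair i a | i a. i \<in> I \<and> a \<in> J}. f k) = (\<Sum>i\<in>I. \<Sum>a\<in>J. f (Pair i a))"
proof -
  have "{Pair i a | i a. i \<in> I \<and> a \<in> J} = case_prod Pair ` (I \<times> J)" by auto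
  moreover have "inj_on (case_prod Pair) (I \<times> J)" by (auto simp: inj_on_def)
  ultimately show ?thesis by (simp add: sum.reindex sum.cartesian_product split_def)
qed

lemma diff_cocycle_prod:
  assumes G: "diff_cocycle I G" and H: "diff_cocycle J H"
  shows "diff_cocycle {Pair i a | i a. i \<in> I \<and> a \<in> J} (\<lambda>c d x k l. case (k, l) of
    (Pair i a, Pair j b) \<Rightarrow> G c d x i j * H c d x a b | _ \<Rightarrow> 0)"
proof -
  have "finite ((\<lambda>(i, a). Pair i a) ` (I \<times> J))" using G H by (simp add: diff_cocycle_def)
  moreover have "(\<lambda>(i, a). Pair i a) ` (I \<times> J) = {Pair i a | i a. i \<in> I \<and> a \<in> J}" by auto
  moreover have "(\<Sum>j\<in>I. \<Sum>b\<in>J. (G c d x i j * H c d x a b) * (G d e x j k * H d e x b l))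
      = G c e x i k * H c e x a l"
    if "in_chart c x" "in_chart d x" "in_chart e x" "i \<in> I" "k \<in> I" "a \<in> J" "l \<in> J" for c d e x i k a l
  proof -
    have "(\<Sum>j\<in>I. \<Sum>b\<in>J. (G c d x i j * H c d x a b) * (G d e x j k * H d e x b l))
       = (\<Sum>j\<in>I. G c d x i j * G d e x j k) * (\<Sum>b\<in>J. H c d x a b * H d e x b l)"
      by (simp add: sum_product mult_ac)
    then show ?thesis using G H that by (simp add: diff_cocycle_def)
  qed
  ultimately show ?thesis
    using G H unfolding diff_cocycle_def sum_Pair by (auto intro!: diff_at_mult)
qed

text \<open>The cocycle identity for the Jacobian matrices is the chain rule; it is also where the second derivatives of the
  coordinate changes enter, as first derivatives of the transition matrices.\<close>

lemma diff_cocycle_tangent: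
  "diff_cocycle (range Base) (\<lambda>c d x i j.
     case (i, j) of (Base l, Base m) \<Rightarrow> pd M d m (\<lambda>y. xc M c y $ l) x | _ \<Rightarrow> 0)"
proof -
  have "(\<Sum>m\<in>UNIV. pd M d m (\<lambda>y. xc M c y $ l) x * pd M e k (\<lambda>y. xc M d y $ m) x)
      = pd M e k (\<lambda>y. xc M c y $ l) x"
    if "in_chart c x" "in_chart d x" "in_chart e x" for c d e x l k
    using pd_chain[OF that(3,2) diff_at_coordinate[OF that(2,1)]] by (simp add: mult.commute)
  moreover have "diff_at M c (pd M d m (\<lambda>y. xc M c y $ l)) x"
    if c: "in_chart c x" and d: "in_chart d x" for c d x l m
  proof -
    have "smooth_in M d (cdom M d \<inter> cdom M c) (\<lambda>y. xc M c y $ l)"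
      using smooth_manifold c d by (simp add: smooth_manifold_def in_chart_def)
    then have "smooth_in M d (cdom M d \<inter> cdom M c) (pd M d m (\<lambda>y. xc M c y $ l))"
      using c d open_cdom by (intro smooth_in_pd) (auto simp: in_chart_def)
    then have "diff_at M d (pd M d m (\<lambda>y. xc M c y $ l)) x"
      using c d by (intro smooth_in_imp_diff_at) (auto simp: in_chart_def)
    then show ?thesis using c d diff_at_change_chart by blast
  qed
  ultimately show ?thesis
    unfolding diff_cocycle_def by (auto simp: pd_coordinate_self sum.reindex inj_on_def)
qed

lemma trivial_diff_bundle: "diff_bundle (trivial_bundle M)"
  unfolding trivial_bundle_def by (rule assoc_bundle_diff_bundle[OF diff_cocycle_trivial])

lemma trans_fn_trivial:
  "in_chart c x \<Longrightarrow> in_chart d x \<Longrightarrow> trans_fn (trivial_bundle M) c d x Triv Triv = 1"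
  using assoc_bundle_trans_fn[OF diff_cocycle_trivial, of c x d Triv Triv]
  unfolding trivial_bundle_def by blast

lemma tangent_diff_bundle: "diff_bundle (tangent_bundle M)"
  unfolding tangent_bundle_def by (rule assoc_bundle_diff_bundle[OF diff_cocycle_tangent])

lemma trans_fn_tangent:
  "in_chart c x \<Longrightarrow> in_chart d x \<Longrightarrow>
    trans_fn (tangent_bundle M) c d x (Base l) (Base m) = pd M d m (\<lambda>y. xc M c y $ l) x"
  using assoc_bundle_trans_fn[OF diff_cocycle_tangent, of c x d "Base l" "Base m"]
  unfolding tangent_bundle_def by simp

lemma dual_diff_bundle: "diff_bundle F \<Longrightarrow> diff_bundle (dual_bundle M F)"
  unfolding dual_bundle_def
  by (rule assoc_bundle_diff_bundle[OF diff_cocycle_dual[OF diff_bundle_cocycle]])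

lemma trans_fn_dual:
  "diff_bundle F \<Longrightarrow> in_chart c x \<Longrightarrow> in_chart d x \<Longrightarrow> i \<in> fidx F \<Longrightarrow> j \<in> fidx F \<Longrightarrow>
    trans_fn (dual_bundle M F) c d x i j = trans_fn F d c x j i"
  using assoc_bundle_trans_fn[OF diff_cocycle_dual[OF diff_bundle_cocycle], of F c x d i j]
  unfolding dual_bundle_def by blast

lemma prod_diff_bundle: "diff_bundle F \<Longrightarrow> diff_bundle F' \<Longrightarrow> diff_bundle (prod_bundle M F F')"
  unfolding prod_bundle_def
  by (rule assoc_bundle_diff_bundle[OF diff_cocycle_prod[OF diff_bundle_cocycle diff_bundle_cocycle]])

lemma trans_fn_prod:
  "diff_bundle F \<Longrightarrow> diff_bundle F' \<Longrightarrow> in_chart c x \<Longrightarrow> in_chart d x \<Longrightarrow>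
    i \<in> fidx F \<Longrightarrow> j \<in> fidx F \<Longrightarrow> a \<in> fidx F' \<Longrightarrow> b \<in> fidx F' \<Longrightarrow>
    trans_fn (prod_bundle M F F') c d x (Pair i a) (Pair j b) = trans_fn F c d x i j * trans_fn F' c d x a b"
  using assoc_bundle_trans_fn[OF diff_cocycle_prod[OF diff_bundle_cocycle diff_bundle_cocycle],
    of F F' c x d "Pair i a" "Pair j b"]
  unfolding prod_bundle_def by simp

lemma bundle_selectors:
  "fidx (trivial_bundle M) = {Triv}" "crd (trivial_bundle M) = (\<lambda>c x w. w c)"
  "fidx (tangent_bundle M) = range Base" "crd (tangent_bundle M) = (\<lambda>c x w. w c)"
  "fidx (dual_bundle M F) = fidx F" "crd (dual_bundle M F) = (\<lambda>c x w. w c)"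
  "fidx (prod_bundle M G H) = {Pair i a | i a. i \<in> fidx G \<and> a \<in> fidx H}"
  "crd (prod_bundle M G H) = (\<lambda>c x w. w c)"
  by (simp_all add: trivial_bundle_def tangent_bundle_def dual_bundle_def prod_bundle_def assoc_bundle_def)

section \<open>Connections and their transformation law\<close>

text \<open>A connection reduced to its coefficients: they are smooth, they describe the action on
  the fibres, and they obey the law $A_c G = \partial G + G B$ under a change of charts. For the dual and product
  connections, which are given by their coefficients, this can be read off, whereas the local
  sections whose jets are their values are not given explicitly.\<close>

definition diff_connection ::
  "('c, 'm, 'n, 'v) vbundle \<Rightarrow> ('m \<Rightarrow> 'v \<Rightarrow> ('c, 'n) jet) \<Rightarrow> bool" where
  "diff_connection F K \<longleftrightarrow>
     (\<forall>c\<in>charts M. \<forall>j\<in>fidx F. \<forall>i\<in>fidx F. \<forall>l. smooth_in M c (cdom M c) (coef F K c j i l)) \<and>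
     (\<forall>c x l. in_chart c x \<longrightarrow> (\<forall>v\<in>fib F x. \<forall>i\<in>fidx F.
        snd (K x v c) l i = (\<Sum>j\<in>fidx F. coef F K c j i l x * crd F c x v j))) \<and>
     (\<forall>c d x l. in_chart c x \<longrightarrow> in_chart d x \<longrightarrow> (\<forall>i\<in>fidx F. \<forall>k\<in>fidx F.
        (\<Sum>j\<in>fidx F. coef F K c j i l x * trans_fn F c d x j k) =
        pd M c l (\<lambda>y. trans_fn F c d y i k) x + (\<Sum>j\<in>fidx F. trans_fn F c d x i j *
          (\<Sum>m\<in>UNIV. pd M c l (\<lambda>y. xc M d y $ m) x * coef F K d k j m x))))"

lemma trans_fn_inverse:
  assumes F: "diff_bundle F" and "in_chart c x" "in_chart d x" "i \<in> fidx F" "k \<in> fidx F"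
  shows "(\<Sum>j\<in>fidx F. trans_fn F c d x i j * trans_fn F d c x j k) = (if i = k then 1 else 0)"
proof -
  have "(\<Sum>j\<in>fidx F. trans_fn F c d x i j * trans_fn F d c x j k) = trans_fn F c c x i k"
    using diff_bundle_cocycle[OF F] assms(2-5) unfolding diff_cocycle_def by blast
  also have "\<dots> = (if i = k then 1 else 0)"
    using diff_bundle_cocycle[OF F] assms(2-5) unfolding diff_cocycle_def by blast
  finally show ?thesis .
qed

lemma diff_at_trans_fn:
  "diff_bundle F \<Longrightarrow> in_chart c x \<Longrightarrow> in_chart d x \<Longrightarrow> in_chart e x \<Longrightarrow> i \<in> fidx F \<Longrightarrow> j \<in> fidx F \<Longrightarrow>
    diff_at M e (\<lambda>y. trans_fn F c d y i j) x"
  by (rule diff_at_change_chart[of e x c]) (simp_all add: diff_bundle_def)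

text \<open>The source of the inhomogeneous term of the transformation law: the derivative of $s_c = G\,s_d$ by the product
  rule, with the derivative of $s_d$ rewritten in the coordinates of d.\<close>

lemma pd_section_change_chart:
  assumes F: "diff_bundle F" and c: "in_chart c x" and d: "in_chart d x" and "i \<in> fidx F"
    and U: "open U" "x \<in> U" "\<And>y. y \<in> U \<Longrightarrow> s y \<in> fib F y"
    and s: "\<And>j. j \<in> fidx F \<Longrightarrow> diff_at M d (\<lambda>y. crd F d y (s y) j) x"
  shows "pd M c l (\<lambda>y. crd F c y (s y) i) x =
    (\<Sum>j\<in>fidx F. pd M c l (\<lambda>y. trans_fn F c d y i j) x * crd F d x (s x) j + trans_fn F c d x i j *
       (\<Sum>m\<in>UNIV. pd M c l (\<lambda>y. xc M d y $ m) x * pd M d m (\<lambda>y. crd F d y (s y) j) x))"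
proof -
  have T: "diff_at M c (\<lambda>y. trans_fn F c d y i j) x" if "j \<in> fidx F" for j
    using diff_at_trans_fn[OF F c d c assms(4) that] .
  have sc: "diff_at M c (\<lambda>y. crd F d y (s y) j) x" if "j \<in> fidx F" for j
    using diff_at_change_chart[OF c d s[OF that]] .
  have "pd M c l (\<lambda>y. crd F c y (s y) i) x =
      pd M c l (\<lambda>y. \<Sum>j\<in>fidx F. trans_fn F c d y i j * crd F d y (s y) j) x"
  proof (rule pd_cong[OF c])
    show "open (U \<inter> cdom M d)" "x \<in> U \<inter> cdom M d"
      using U d open_cdom by (auto simp: in_chart_def)
    show "crd F c y (s y) i = (\<Sum>j\<in>fidx F. trans_fn F c d y i j * crd F d y (s y) j)"
      if "y \<in> U \<inter> cdom M d" "in_chart c y" for y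
      using that U d by (intro crd_change_chart[OF F]) (auto simp: in_chart_def)
  qed
  also have "\<dots> = (\<Sum>j\<in>fidx F. pd M c l (\<lambda>y. trans_fn F c d y i j * crd F d y (s y) j) x)"
    by (intro pd_sum finite_fidx[OF F] diff_at_mult T sc)
  also have "\<dots> = (\<Sum>j\<in>fidx F. pd M c l (\<lambda>y. trans_fn F c d y i j) x * crd F d x (s x) j +
      trans_fn F c d x i j * pd M c l (\<lambda>y. crd F d y (s y) j) x)"
    by (intro sum.cong refl pd_mult T sc c)
  also have "\<dots> = (\<Sum>j\<in>fidx F. pd M c l (\<lambda>y. trans_fn F c d y i j) x * crd F d x (s x) j + trans_fn F c d x i j *
       (\<Sum>m\<in>UNIV. pd M c l (\<lambda>y. xc M d y $ m) x * pd M d m (\<lambda>y. crd F d y (s y) j) x))"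
    by (intro sum.cong refl) (simp add: pd_chain[OF c d s])
  finally show ?thesis .
qed

text \<open>The value of K on a frame vector of the chart d is the jet of a local section, and jets
  of sections transform by the product rule. Comparing the coordinates of this jet in c and in d is the law.\<close>

lemma linear_connection_imp_diff_connection:
  assumes F: "diff_bundle F" and K: "linear_connection M F K"
  shows "diff_connection F K"
proof -
  have action: "snd (K x v c) l i = (\<Sum>j\<in>fidx F. coef F K c j i l x * crd F c x v j)"
    if c: "in_chart c x" and v: "v \<in> fib F x" for c x v l i
    unfolding coef_def using K
    by (intro linear_frame_expansion[OF F c _ _ v, of "\<lambda>v. snd (K x v c) l i"])
      (auto simp: linear_connection_def jet_add_def jet_scale_def)
  have law: "(\<Sum>j\<in>fidx F. coef F K c j i l x * trans_fn F c d x j k) =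
        pd M c l (\<lambda>y. trans_fn F c d y i k) x + (\<Sum>j\<in>fidx F. trans_fn F c d x i j *
          (\<Sum>m\<in>UNIV. pd M c l (\<lambda>y. xc M d y $ m) x * coef F K d k j m x))"
    if c: "in_chart c x" and d: "in_chart d x" and i: "i \<in> fidx F" and k: "k \<in> fidx F" for c d x l i k
  proof -
    define v where "v = frame F d x k"
    have v: "v \<in> fib F x" unfolding v_def by (rule frame_in_fib[OF F d k])
    then obtain s where Kv: "K x v = j1 M F s x" and "local_section M F x s" and sx: "s x = v"
      using K unfolding linear_connection_def J1_over_def by blast
    then obtain U where U: "open U" "x \<in> U" "\<And>y. y \<in> U \<Longrightarrow> s y \<in> fib F y"
      "\<And>c i. c \<in> charts M \<Longrightarrow> i \<in> fidx F \<Longrightarrow> smooth_in M c (U \<inter> cdom M c) (\<lambda>y. crd F c y (s y) i)"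
      unfolding local_section_def by blast
    have jet: "snd (K x v e) m j = pd M e m (\<lambda>y. crd F e y (s y) j) x"
      if "in_chart e x" "j \<in> fidx F" for e m j
      using that by (simp add: Kv j1_def in_chart_def)
    have "(\<Sum>j\<in>fidx F. coef F K c j i l x * trans_fn F c d x j k) = snd (K x v c) l i"
      unfolding trans_fn_def v_def[symmetric] by (rule action[OF c v, symmetric])
    also have "\<dots> = pd M c l (\<lambda>y. crd F c y (s y) i) x" by (rule jet[OF c i])
    also have "\<dots> = (\<Sum>j\<in>fidx F. pd M c l (\<lambda>y. trans_fn F c d y i j) x * crd F d x (s x) j + trans_fn F c d x i j *
       (\<Sum>m\<in>UNIV. pd M c l (\<lambda>y. xc M d y $ m) x * pd M d m (\<lambda>y. crd F d y (s y) j) x))"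
    proof (rule pd_section_change_chart[OF F c d i U(1-3)])
      show "diff_at M d (\<lambda>y. crd F d y (s y) j) x" if "j \<in> fidx F" for j
        using d U(2) that by (intro smooth_in_imp_diff_at[OF U(4)]) (simp_all add: in_chart_def)
    qed
    also have "\<dots> = (\<Sum>j\<in>fidx F. (if j = k then pd M c l (\<lambda>y. trans_fn F c d y i j) x else 0) + trans_fn F c d x i j *
       (\<Sum>m\<in>UNIV. pd M c l (\<lambda>y. xc M d y $ m) x * coef F K d k j m x))"
      by (intro sum.cong) (simp_all add: sx coef_def jet[OF d, symmetric] v_def crd_frame[OF F d k])
    also have "\<dots> = pd M c l (\<lambda>y. trans_fn F c d y i k) x + (\<Sum>j\<in>fidx F. trans_fn F c d x i j *
          (\<Sum>m\<in>UNIV. pd M c l (\<lambda>y. xc M d y $ m) x * coef F K d k j m x))"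
      using k finite_fidx[OF F] by (simp add: sum.distrib)
    finally show ?thesis .
  qed
  have smooth: "smooth_in M c (cdom M c) (coef F K c j i l)"
    if "c \<in> charts M" "j \<in> fidx F" "i \<in> fidx F" for c j i l
    using K that by (simp add: linear_connection_def)
  show ?thesis
    unfolding diff_connection_def by (intro conjI allI impI ballI smooth action law)
qed

lemma trivial_diff_connection: "diff_connection (trivial_bundle M) (trivial_connection M)"
proof -
  have coef: "coef (trivial_bundle M) (trivial_connection M) c j i l = (\<lambda>x. 0)" for c j i l
    unfolding coef_def trivial_connection_def by simp
  have "pd M c l (\<lambda>y. trans_fn (trivial_bundle M) c d y Triv Triv) x = 0"
    if c: "in_chart c x" and d: "in_chart d x" for c d x l
  proof -
    have "pd M c l (\<lambda>y. trans_fn (trivial_bundle M) c d y Triv Triv) x = pd M c l (\<lambda>y. 1) x"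
      using d open_cdom[of d] trans_fn_trivial
      by (intro pd_cong[OF c, of "cdom M d"]) (auto simp: in_chart_def)
    then show ?thesis by (simp add: pd_const)
  qed
  then show ?thesis
    unfolding diff_connection_def bundle_selectors coef
    by (intro conjI allI impI ballI) (auto simp: smooth_in_const trivial_connection_def)
qed

text \<open>The derivative of the constant matrix $G_{dc}\,G_{cd} = 1$ vanishes.\<close>

lemma pd_trans_fn_inverse:
  assumes F: "diff_bundle F" and c: "in_chart c x" and d: "in_chart d x" and i: "i \<in> fidx F" and k: "k \<in> fidx F"
  shows "(\<Sum>j\<in>fidx F. pd M c l (\<lambda>y. trans_fn F d c y i j) x * trans_fn F c d x j k) =
    - (\<Sum>j\<in>fidx F. trans_fn F d c x i j * pd M c l (\<lambda>y. trans_fn F c d y j k) x)"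
proof -
  have "pd M c l (\<lambda>y. \<Sum>j\<in>fidx F. trans_fn F d c y i j * trans_fn F c d y j k) x
      = pd M c l (\<lambda>y. if i = k then 1 else 0) x"
    using d open_cdom[of d] i k
    by (intro pd_cong[OF c, of "cdom M d"]) (auto simp: in_chart_def trans_fn_inverse[OF F])
  also have "\<dots> = 0" by (rule pd_const)
  also have "pd M c l (\<lambda>y. \<Sum>j\<in>fidx F. trans_fn F d c y i j * trans_fn F c d y j k) x =
    (\<Sum>j\<in>fidx F. pd M c l (\<lambda>y. trans_fn F d c y i j * trans_fn F c d y j k) x)"
    using finite_fidx[OF F] c d i k by (intro pd_sum diff_at_mult diff_at_trans_fn[OF F])
  also have "\<dots> = (\<Sum>j\<in>fidx F. pd M c l (\<lambda>y. trans_fn F d c y i j) x * trans_fn F c d x j k +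
      trans_fn F d c x i j * pd M c l (\<lambda>y. trans_fn F c d y j k) x)"
    using c d i k by (intro sum.cong refl pd_mult diff_at_trans_fn[OF F])
  finally show ?thesis by (simp add: sum.distrib)
qed

lemma sum_mult_assoc:
  fixes P Q R :: "'a \<Rightarrow> 'a \<Rightarrow> real"
  shows "(\<Sum>j\<in>I. (\<Sum>k\<in>I. P i k * Q k j) * R j l) = (\<Sum>k\<in>I. P i k * (\<Sum>j\<in>I. Q k j * R j l))"
  unfolding sum_distrib_left sum_distrib_right by (subst sum.swap) (simp add: mult_ac)

text \<open>The law of the dual connection in matrix form. With $H = G^{-1}$ put
  $Z = HA + \partial H - BH$. Then $ZG = H(\partial G + GB) + (\partial H)G - B = \partial(HG) = 0$, so $Z = 0$.
  Up to transposition this is $A^* G^* = \partial G^* + G^* B^*$ for $A^* = -A^T$, $B^* = -B^T$, $G^* = H^T$.\<close>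

lemma transpose_transformation_law:
  fixes A B G H DG DH :: "'a \<Rightarrow> 'a \<Rightarrow> real"
  assumes fin: "finite I"
    and GH: "\<And>i k. i \<in> I \<Longrightarrow> k \<in> I \<Longrightarrow> (\<Sum>j\<in>I. G i j * H j k) = (if i = k then 1 else 0)"
    and HG: "\<And>i k. i \<in> I \<Longrightarrow> k \<in> I \<Longrightarrow> (\<Sum>j\<in>I. H i j * G j k) = (if i = k then 1 else 0)"
    and DHG: "\<And>i k. i \<in> I \<Longrightarrow> k \<in> I \<Longrightarrow> (\<Sum>j\<in>I. DH i j * G j k) = - (\<Sum>j\<in>I. H i j * DG j k)"
    and law: "\<And>i k. i \<in> I \<Longrightarrow> k \<in> I \<Longrightarrow>
      (\<Sum>j\<in>I. A i j * G j k) = DG i k + (\<Sum>j\<in>I. G i j * B j k)"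
    and ik: "i \<in> I" "k \<in> I"
  shows "(\<Sum>j\<in>I. H i j * A j k) = (\<Sum>j\<in>I. B i j * H j k) - DH i k"
proof -
  define Z where "Z = (\<lambda>i k. (\<Sum>j\<in>I. H i j * A j k) + DH i k - (\<Sum>j\<in>I. B i j * H j k))"
  have "(\<Sum>j\<in>I. Z i j * G j l) = 0" if l: "l \<in> I" for l
  proof -
    have "(\<Sum>j\<in>I. Z i j * G j l) = (\<Sum>j\<in>I. (\<Sum>k\<in>I. H i k * A k j) * G j l) + (\<Sum>j\<in>I. DH i j * G j l)
        - (\<Sum>j\<in>I. (\<Sum>k\<in>I. B i k * H k j) * G j l)"
      unfolding Z_def by (simp add: algebra_simps sum.distrib sum_subtractf)
    also have "(\<Sum>j\<in>I. (\<Sum>k\<in>I. H i k * A k j) * G j l) = (\<Sum>k\<in>I. H i k * DG k l) + B i l"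
    proof -
      have "(\<Sum>j\<in>I. (\<Sum>k\<in>I. H i k * A k j) * G j l) = (\<Sum>k\<in>I. H i k * (DG k l + (\<Sum>j\<in>I. G k j * B j l)))"
        unfolding sum_mult_assoc using l by (intro sum.cong) (simp_all add: law)
      also have "\<dots> = (\<Sum>k\<in>I. H i k * DG k l) + (\<Sum>j\<in>I. (\<Sum>k\<in>I. H i k * G k j) * B j l)"
        unfolding sum_mult_assoc by (simp add: distrib_left sum.distrib)
      also have "(\<Sum>j\<in>I. (\<Sum>k\<in>I. H i k * G k j) * B j l) = (\<Sum>j\<in>I. if j = i then B j l else 0)"
        using ik by (intro sum.cong) (auto simp: HG)
      finally show ?thesis using fin ik by simp
    qed
    also have "(\<Sum>j\<in>I. (\<Sum>k\<in>I. B i k * H k j) * G j l) = (\<Sum>k\<in>I. if k = l then B i k else 0)"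
      unfolding sum_mult_assoc using l by (intro sum.cong) (auto simp: HG)
    finally show ?thesis using fin ik l by (simp add: DHG)
  qed
  then have "(\<Sum>l\<in>I. (\<Sum>j\<in>I. Z i j * G j l) * H l k) = 0" by simp
  moreover have "(\<Sum>l\<in>I. (\<Sum>j\<in>I. Z i j * G j l) * H l k) = (\<Sum>j\<in>I. if j = k then Z i j else 0)"
    unfolding sum_mult_assoc using ik by (intro sum.cong) (auto simp: GH)
  ultimately show ?thesis using fin ik by (simp add: Z_def)
qed

lemma coef_dual:
  assumes "diff_bundle F" and c: "in_chart c x" and i: "i \<in> fidx F" and j: "j \<in> fidx F"
  shows "coef (dual_bundle M F) (dual_connection M F K) c j i l x = - coef F K c i j l x"
proof -
  let ?e = "frame (dual_bundle M F) c x j"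
  have e: "?e c k = (if k = j then 1 else 0)" for k
    using crd_frame[OF dual_diff_bundle[OF assms(1)] c, of j k] j by (simp add: bundle_selectors)
  have "(\<Sum>k\<in>fidx F. coef F K c i k l x * ?e c k) = (\<Sum>k\<in>fidx F. if k = j then coef F K c i k l x else 0)"
    by (intro sum.cong refl) (simp add: e)
  then show ?thesis
    using c i j finite_fidx[OF assms(1)] unfolding coef_def[of "dual_bundle M F"] dual_connection_def
    by (simp add: in_chart_def)
qed

lemma dual_diff_connection:
  assumes F: "diff_bundle F" and K: "diff_connection F K"
  shows "diff_connection (dual_bundle M F) (dual_connection M F K)"
  unfolding diff_connection_def bundle_selectors
proof (intro conjI allI impI ballI)
  fix c j i l assume c: "c \<in> charts M" and j: "j \<in> fidx F" and i: "i \<in> fidx F"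
  have sm: "smooth_in M c (cdom M c) (\<lambda>x. 0 - coef F K c i j l x)"
    using K c i j by (intro smooth_in_diff smooth_in_const) (auto simp: diff_connection_def)
  have eq: "coef (dual_bundle M F) (dual_connection M F K) c j i l x = 0 - coef F K c i j l x"
    if "x \<in> cdom M c" for x
    using coef_dual[OF F _ i j] c that by (simp add: in_chart_def)
  show "smooth_in M c (cdom M c) (coef (dual_bundle M F) (dual_connection M F K) c j i l)"
    by (rule iffD2[OF smooth_in_cong[OF c open_cdom[OF c] order_refl] sm]) (rule eq)
next
  fix c x l w i assume c: "in_chart c x" and i: "i \<in> fidx F"
  have "snd (dual_connection M F K x w c) l i = - (\<Sum>j\<in>fidx F. coef F K c i j l x * w c j)"
    using c i by (simp add: dual_connection_def in_chart_def)
  then show "snd (dual_connection M F K x w c) l i =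
      (\<Sum>j\<in>fidx F. coef (dual_bundle M F) (dual_connection M F K) c j i l x * w c j)"
    by (simp add: coef_dual[OF F c i] sum_negf)
next
  fix c d x l i k
  assume c: "in_chart c x" and d: "in_chart d x" and i: "i \<in> fidx F" and k: "k \<in> fidx F"
  let ?X = "\<lambda>m. pd M c l (\<lambda>y. xc M d y $ m) x"
  have "(\<Sum>j\<in>fidx F. trans_fn F d c x k j * coef F K c i j l x) =
      (\<Sum>j\<in>fidx F. (\<Sum>m\<in>UNIV. ?X m * coef F K d j k m x) * trans_fn F d c x j i)
      - pd M c l (\<lambda>y. trans_fn F d c y k i) x"
    using K c d k i
    by (intro transpose_transformation_law[where G = "trans_fn F c d x" and DG = "\<lambda>i k. pd M c l (\<lambda>y. trans_fn F c d y i k) x"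
          and A = "\<lambda>i j. coef F K c j i l x" and B = "\<lambda>j k. \<Sum>m\<in>UNIV. ?X m * coef F K d k j m x"])
      (auto simp: finite_fidx[OF F] trans_fn_inverse[OF F] pd_trans_fn_inverse[OF F] diff_connection_def)
  moreover have "pd M c l (\<lambda>y. trans_fn (dual_bundle M F) c d y i k) x = pd M c l (\<lambda>y. trans_fn F d c y k i) x"
    using d open_cdom[of d] i k
    by (intro pd_cong[OF c, of "cdom M d"]) (auto simp: in_chart_def trans_fn_dual[OF F])
  ultimately show "(\<Sum>j\<in>fidx F. coef (dual_bundle M F) (dual_connection M F K) c j i l x * trans_fn (dual_bundle M F) c d x j k) =
      pd M c l (\<lambda>y. trans_fn (dual_bundle M F) c d y i k) x +
      (\<Sum>j\<in>fidx F. trans_fn (dual_bundle M F) c d x i j *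
        (\<Sum>m\<in>UNIV. ?X m * coef (dual_bundle M F) (dual_connection M F K) d k j m x))"
    using c d i k by (simp add: trans_fn_dual[OF F] coef_dual[OF F] sum_negf mult.commute)
qed

text \<open>Multiplication by a matrix of the form $P \otimes 1 + 1 \otimes Q$, the shape of the
  coefficients of a product connection.\<close>

lemma sum_if_Pair:
  fixes P Q :: "'a \<Rightarrow> real"
  assumes "finite I" "finite J" "i \<in> I" "a \<in> J"
  shows "(\<Sum>j\<in>I. \<Sum>b\<in>J. ((if b = a then P j else 0) + (if j = i then Q b else 0)) * w j b) =
    (\<Sum>j\<in>I. P j * w j a) + (\<Sum>b\<in>J. Q b * w i b)"
proof -
  have "(\<Sum>j\<in>I. \<Sum>b\<in>J. (if j = i then Q b else 0) * w j b) = (\<Sum>j\<in>I. if j = i then \<Sum>b\<in>J. Q b * w j b else 0)"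
    by (intro sum.cong) auto
  moreover have "(\<Sum>j\<in>I. \<Sum>b\<in>J. (if b = a then P j else 0) * w j b) = (\<Sum>j\<in>I. \<Sum>b\<in>J. if b = a then P j * w j b else 0)"
    by (intro sum.cong) auto
  ultimately show ?thesis using assms by (simp add: distrib_right sum.distrib)
qed

context
  fixes F :: "('c, 'm, 'n, 'v) vbundle" and F' :: "('c, 'm, 'n, 'w) vbundle"
    and K :: "'m \<Rightarrow> 'v \<Rightarrow> ('c, 'n) jet" and K' :: "'m \<Rightarrow> 'w \<Rightarrow> ('c, 'n) jet"
  assumes F: "diff_bundle F" and F': "diff_bundle F'"
begin

lemma prod_connection_Pair:
  assumes "in_chart c x" "i \<in> fidx F" "a \<in> fidx F'"
  shows "snd (prod_connection M F F' K K' x w c) l (Pair i a) =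
    (\<Sum>j\<in>fidx F. coef F K c j i l x * w c (Pair j a)) +
    (\<Sum>b\<in>fidx F'. coef F' K' c b a l x * w c (Pair i b))"
  using assms by (simp add: prod_connection_def in_chart_def)

lemma coef_prod:
  assumes c: "in_chart c x" and i: "i \<in> fidx F" and j: "j \<in> fidx F" and a: "a \<in> fidx F'" and b: "b \<in> fidx F'"
  shows "coef (prod_bundle M F F') (prod_connection M F F' K K') c (Pair j b) (Pair i a) l x =
    (if b = a then coef F K c j i l x else 0) + (if j = i then coef F' K' c b a l x else 0)"
proof -
  let ?e = "frame (prod_bundle M F F') c x (Pair j b)"
  have e: "?e c k = (if k = Pair j b then 1 else 0)" for k
    using crd_frame[OF prod_diff_bundle[OF F F'] c, of "Pair j b" k] j b by (simp add: bundle_selectors)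
  have "(\<Sum>k\<in>fidx F. coef F K c k i l x * ?e c (Pair k a)) =
      (\<Sum>k\<in>fidx F. if k = j then (if b = a then coef F K c k i l x else 0) else 0)"
    by (intro sum.cong) (auto simp: e)
  moreover have "(\<Sum>k\<in>fidx F'. coef F' K' c k a l x * ?e c (Pair i k)) =
      (\<Sum>k\<in>fidx F'. if k = b then (if j = i then coef F' K' c k a l x else 0) else 0)"
    by (intro sum.cong) (auto simp: e)
  ultimately show ?thesis
    unfolding coef_def[of "prod_bundle M F F'"] prod_connection_Pair[OF c i a]
    using j b finite_fidx[OF F] finite_fidx[OF F'] by simp
qed

text \<open>With $A \otimes 1 + 1 \otimes A'$ for the coefficients and $G \otimes G'$ for the transition matrices, the law
  is the sum of the two given laws, because $\partial(G \otimes G') = \partial G \otimes G' + G \otimes \partial G'$.\<close>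

lemma prod_diff_connection:
  assumes K: "diff_connection F K" and K': "diff_connection F' K'"
  shows "diff_connection (prod_bundle M F F') (prod_connection M F F' K K')"
  unfolding diff_connection_def bundle_selectors sum_Pair
proof (intro conjI allI impI ballI)
  fix c j i l assume c: "c \<in> charts M"
    and "j \<in> {Pair i a | i a. i \<in> fidx F \<and> a \<in> fidx F'}" "i \<in> {Pair i a | i a. i \<in> fidx F \<and> a \<in> fidx F'}"
  then obtain j' b i' a where ji: "j = Pair j' b" "i = Pair i' a"
    and I: "j' \<in> fidx F" "b \<in> fidx F'" "i' \<in> fidx F" "a \<in> fidx F'" by auto
  have "smooth_in M c (cdom M c) (coef F K c j' i' l)" "smooth_in M c (cdom M c) (coef F' K' c b a l)"
    using K K' c I by (auto simp: diff_connection_def)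
  then have sm: "smooth_in M c (cdom M c) (\<lambda>x. (if b = a then coef F K c j' i' l x else 0) +
      (if j' = i' then coef F' K' c b a l x else 0))"
    by (cases "b = a"; cases "j' = i'") (simp_all add: smooth_in_const smooth_in_add[OF c])
  have eq: "coef (prod_bundle M F F') (prod_connection M F F' K K') c j i l x =
      (if b = a then coef F K c j' i' l x else 0) + (if j' = i' then coef F' K' c b a l x else 0)"
    if "x \<in> cdom M c" for x
    unfolding ji using c that I by (intro coef_prod) (auto simp: in_chart_def)
  show "smooth_in M c (cdom M c) (coef (prod_bundle M F F') (prod_connection M F F' K K') c j i l)"
    by (rule iffD2[OF smooth_in_cong[OF c open_cdom[OF c] order_refl] sm]) (rule eq)
next
  fix c x l w k assume c: "in_chart c x" and "k \<in> {Pair i a | i a. i \<in> fidx F \<and> a \<in> fidx F'}"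
  then obtain i a where k: "k = Pair i a" and ia: "i \<in> fidx F" "a \<in> fidx F'" by auto
  have "(\<Sum>j\<in>fidx F. \<Sum>b\<in>fidx F'. coef (prod_bundle M F F') (prod_connection M F F' K K') c (Pair j b) k l x * w c (Pair j b))
     = (\<Sum>j\<in>fidx F. \<Sum>b\<in>fidx F'. ((if b = a then coef F K c j i l x else 0) + (if j = i then coef F' K' c b a l x else 0)) * w c (Pair j b))"
    unfolding k using coef_prod[OF c] ia by (intro sum.cong refl) simp
  then show "snd (prod_connection M F F' K K' x w c) l k = (\<Sum>j\<in>fidx F. \<Sum>b\<in>fidx F'.
      coef (prod_bundle M F F') (prod_connection M F F' K K') c (Pair j b) k l x * w c (Pair j b))"
    using ia finite_fidx[OF F] finite_fidx[OF F'] by (simp add: k prod_connection_Pair[OF c] sum_if_Pair)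
next
  fix c d x l p q
  assume c: "in_chart c x" and d: "in_chart d x" and "p \<in> {Pair i a | i a. i \<in> fidx F \<and> a \<in> fidx F'}"
    and "q \<in> {Pair i a | i a. i \<in> fidx F \<and> a \<in> fidx F'}"
  then obtain i a k b where pq: "p = Pair i a" "q = Pair k b"
    and ia: "i \<in> fidx F" "a \<in> fidx F'" and kb: "k \<in> fidx F" "b \<in> fidx F'" by auto
  let ?P = "prod_bundle M F F'" and ?C = "prod_connection M F F' K K'"
  let ?G = "trans_fn F c d" and ?H = "trans_fn F' c d"
  let ?X = "\<lambda>m. pd M c l (\<lambda>y. xc M d y $ m) x"
  define B where "B = (\<lambda>j. \<Sum>m\<in>UNIV. ?X m * coef F K d k j m x)"
  define B' where "B' = (\<lambda>e. \<Sum>m\<in>UNIV. ?X m * coef F' K' d b e m x)"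
  note fin = finite_fidx[OF F] finite_fidx[OF F']
  have "(\<Sum>j\<in>fidx F. \<Sum>e\<in>fidx F'. coef ?P ?C c (Pair j e) p l x * trans_fn ?P c d x (Pair j e) q)
      = (\<Sum>j\<in>fidx F. \<Sum>e\<in>fidx F'. ((if e = a then coef F K c j i l x else 0) + (if j = i then coef F' K' c e a l x else 0))
          * (?G x j k * ?H x e b))"
    unfolding pq using coef_prod[OF c] trans_fn_prod[OF F F' c d] ia kb by (intro sum.cong refl) simp
  also have "\<dots> = (\<Sum>j\<in>fidx F. coef F K c j i l x * ?G x j k) * ?H x a b
      + ?G x i k * (\<Sum>e\<in>fidx F'. coef F' K' c e a l x * ?H x e b)"
    unfolding sum_if_Pair[OF fin ia] by (simp add: sum_distrib_left sum_distrib_right mult_ac)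
  also have "(\<Sum>j\<in>fidx F. coef F K c j i l x * ?G x j k) =
      pd M c l (\<lambda>y. ?G y i k) x + (\<Sum>j\<in>fidx F. ?G x i j * B j)"
    using K c d ia kb by (simp add: diff_connection_def B_def)
  also have "(\<Sum>e\<in>fidx F'. coef F' K' c e a l x * ?H x e b) =
      pd M c l (\<lambda>y. ?H y a b) x + (\<Sum>e\<in>fidx F'. ?H x a e * B' e)"
    using K' c d ia kb by (simp add: diff_connection_def B'_def)
  finally have lhs: "(\<Sum>j\<in>fidx F. \<Sum>e\<in>fidx F'. coef ?P ?C c (Pair j e) p l x * trans_fn ?P c d x (Pair j e) q)
    = (pd M c l (\<lambda>y. ?G y i k) x * ?H x a b + ?G x i k * pd M c l (\<lambda>y. ?H y a b) x)
      + ((\<Sum>j\<in>fidx F. ?G x i j * B j) * ?H x a b + ?G x i k * (\<Sum>e\<in>fidx F'. ?H x a e * B' e))"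
    by (simp add: algebra_simps)
  have "pd M c l (\<lambda>y. trans_fn ?P c d y p q) x = pd M c l (\<lambda>y. ?G y i k * ?H y a b) x"
    unfolding pq using d open_cdom[of d] ia kb
    by (intro pd_cong[OF c, of "cdom M d"]) (auto simp: in_chart_def trans_fn_prod[OF F F'])
  also have "\<dots> = pd M c l (\<lambda>y. ?G y i k) x * ?H x a b + ?G x i k * pd M c l (\<lambda>y. ?H y a b) x"
    using c d ia kb by (intro pd_mult diff_at_trans_fn F F')
  finally have deriv: "pd M c l (\<lambda>y. trans_fn ?P c d y p q) x =
      pd M c l (\<lambda>y. ?G y i k) x * ?H x a b + ?G x i k * pd M c l (\<lambda>y. ?H y a b) x" .
  have coefd: "(\<Sum>m\<in>UNIV. ?X m * coef ?P ?C d q (Pair j e) m x) = (if e = b then B j else 0) + (if j = k then B' e else 0)"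
    if "j \<in> fidx F" "e \<in> fidx F'" for j e
    unfolding pq B_def B'_def using that kb
    by (auto simp: coef_prod[OF d] distrib_left sum.distrib)
  have "(\<Sum>j\<in>fidx F. \<Sum>e\<in>fidx F'. trans_fn ?P c d x p (Pair j e) * (\<Sum>m\<in>UNIV. ?X m * coef ?P ?C d q (Pair j e) m x))
      = (\<Sum>j\<in>fidx F. \<Sum>e\<in>fidx F'. ((if e = b then B j else 0) + (if j = k then B' e else 0)) * (?G x i j * ?H x a e))"
    using ia by (intro sum.cong refl) (simp add: coefd pq(1) trans_fn_prod[OF F F' c d])
  also have "\<dots> = (\<Sum>j\<in>fidx F. ?G x i j * B j) * ?H x a b + ?G x i k * (\<Sum>e\<in>fidx F'. ?H x a e * B' e)"
    unfolding sum_if_Pair[OF fin kb] by (simp add: sum_distrib_left sum_distrib_right mult_ac)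
  finally show "(\<Sum>j\<in>fidx F. \<Sum>e\<in>fidx F'. coef ?P ?C c (Pair j e) p l x * trans_fn ?P c d x (Pair j e) q) =
      pd M c l (\<lambda>y. trans_fn ?P c d y p q) x +
      (\<Sum>j\<in>fidx F. \<Sum>e\<in>fidx F'. trans_fn ?P c d x p (Pair j e) *
        (\<Sum>m\<in>UNIV. ?X m * coef ?P ?C d q (Pair j e) m x))"
    unfolding lhs deriv by simp
qed

end

lemma prod_power_diff_bundle:
  "diff_bundle F \<Longrightarrow> diff_bundle G \<Longrightarrow> diff_bundle (prod_power M F G k)"
  by (induction k) (simp_all add: prod_diff_bundle)

lemma prod_power_diff_connection:
  "diff_bundle F \<Longrightarrow> diff_bundle G \<Longrightarrow> diff_connection F K \<Longrightarrow> diff_connection G L \<Longrightarrow>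
    diff_connection (prod_power M F G k) (prod_power_connection M F G K L k)"
  by (induction k) (simp_all add: prod_diff_connection prod_power_diff_bundle)

lemma tensor_bundle_Suc:
  "tensor_bundle M E p q r (Suc s) = prod_bundle M (tensor_bundle M E p q r s) (cotangent_bundle M)"
  by (simp add: tensor_bundle_def)

lemma tensor_connection_Suc:
  "tensor_connection M E K \<Gamma> p q r (Suc s) =
    prod_connection M (tensor_bundle M E p q r s) (cotangent_bundle M)
      (tensor_connection M E K \<Gamma> p q r s) (dual_connection M (tangent_bundle M) \<Gamma>)"
  by (simp add: tensor_bundle_def tensor_connection_def Let_def)

lemma tensor_diff_bundle:
  assumes "diff_bundle E"
  shows "diff_bundle (tensor_bundle M E p q r s)"
  unfolding tensor_bundle_def
  by (intro prod_power_diff_bundle trivial_diff_bundle tangent_diff_bundle dual_diff_bundle assms)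

lemma tensor_diff_connection:
  assumes "diff_bundle E" "diff_connection E K" "diff_connection (tangent_bundle M) \<Gamma>"
  shows "diff_connection (tensor_bundle M E p q r s) (tensor_connection M E K \<Gamma> p q r s)"
  unfolding tensor_bundle_def tensor_connection_def Let_def
  by (intro prod_power_diff_connection prod_power_diff_bundle trivial_diff_bundle tangent_diff_bundle
      dual_diff_bundle trivial_diff_connection dual_diff_connection assms)

section \<open>The covariant differential is a tensor\<close>

lemma sum_range_Base: "(\<Sum>b\<in>range Base. f b) = (\<Sum>n\<in>UNIV. f (Base n))"
  by (simp add: sum.reindex inj_on_def)

lemma cotangent_diff_bundle: "diff_bundle (cotangent_bundle M)"
  by (intro dual_diff_bundle tangent_diff_bundle)

lemma trans_fn_cotangent:
  "in_chart c x \<Longrightarrow> in_chart d x \<Longrightarrow>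
    trans_fn (cotangent_bundle M) c d x (Base l) (Base m) = pd M c l (\<lambda>y. xc M d y $ m) x"
  by (simp add: trans_fn_dual[OF tangent_diff_bundle] bundle_selectors trans_fn_tangent)

lemma prod_bundle_fib:
  "w \<in> fib (prod_bundle M F H) x \<longleftrightarrow>
    (\<forall>c k. \<not> in_chart c x \<or> k \<notin> {Pair i a | i a. i \<in> fidx F \<and> a \<in> fidx H} \<longrightarrow> w c k = 0) \<and>
    (\<forall>c d. in_chart c x \<longrightarrow> in_chart d x \<longrightarrow> (\<forall>i\<in>fidx F. \<forall>a\<in>fidx H.
       w c (Pair i a) = (\<Sum>j\<in>fidx F. \<Sum>b\<in>fidx H.
         trans_fn F c d x i j * trans_fn H c d x a b * w d (Pair j b))))"
proof -
  have ball_Pair: "(\<forall>k\<in>{Pair i a | i a. i \<in> I \<and> a \<in> J}. P k) \<longleftrightarrow> (\<forall>i\<in>I. \<forall>a\<in>J. P (Pair i a))"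
    for I J :: "'n idx set" and P by blast
  show ?thesis
    unfolding prod_bundle_def assoc_bundle_fib sum_Pair ball_Pair prod.case idx.case by (rule refl)
qed

lemma cov_diff_eq_0:
  "\<not> in_chart c x \<or> k \<notin> {Pair i a | i a. i \<in> fidx F \<and> a \<in> range Base} \<Longrightarrow> cov_diff M F K s x c k = 0"
  by (auto simp: cov_diff_def in_chart_def split: idx.splits)

lemma cov_diff_Pair:
  "in_chart c x \<Longrightarrow> i \<in> fidx F \<Longrightarrow> cov_diff M F K s x c (Pair i (Base l)) =
    pd M c l (\<lambda>y. crd F c y (s y) i) x - snd (K x (s x) c) l i"
  by (simp add: cov_diff_def j1_def in_chart_def)

context
  fixes F :: "('c, 'm, 'n, 'v) vbundle" and K :: "'m \<Rightarrow> 'v \<Rightarrow> ('c, 'n) jet" and s :: "'m \<Rightarrow> 'v"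
  assumes F: "diff_bundle F" and K: "diff_connection F K" and s: "s \<in> sections M F"
begin

lemma section_in_fib: "s x \<in> fib F x"
  using s by (simp add: sections_def)

lemma section_smooth: "c \<in> charts M \<Longrightarrow> i \<in> fidx F \<Longrightarrow> smooth_in M c (cdom M c) (\<lambda>y. crd F c y (s y) i)"
  using s by (simp add: sections_def)

lemma section_diff_at: "in_chart c x \<Longrightarrow> i \<in> fidx F \<Longrightarrow> diff_at M c (\<lambda>y. crd F c y (s y) i) x"
  by (rule smooth_in_imp_diff_at[OF section_smooth]) (simp_all add: in_chart_def)

lemma cov_diff_components:
  assumes "in_chart c x" "i \<in> fidx F"
  shows "cov_diff M F K s x c (Pair i (Base l)) = pd M c l (\<lambda>y. crd F c y (s y) i) x -
    (\<Sum>j\<in>fidx F. coef F K c j i l x * crd F c x (s x) j)"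
  using K assms section_in_fib by (simp add: cov_diff_Pair diff_connection_def)

text \<open>The derivative of $s_c = G\,s_d$ and the connection term $A_c G\,s_d$ contain the same inhomogeneous part
  $(\partial G)\,s_d$; in the difference only G times the covariant differential in d is left, with the
  form index transformed by the Jacobian matrix, which is the transition matrix of the cotangent bundle.\<close>

lemma cov_diff_change_chart:
  assumes c: "in_chart c x" and d: "in_chart d x" and i: "i \<in> fidx F"
  shows "cov_diff M F K s x c (Pair i (Base l)) = (\<Sum>j\<in>fidx F. \<Sum>m\<in>UNIV.
    trans_fn F c d x i j * pd M c l (\<lambda>y. xc M d y $ m) x * cov_diff M F K s x d (Pair j (Base m)))"
proof -
  let ?T = "\<lambda>i j y. trans_fn F c d y i j" and ?X = "\<lambda>m. pd M c l (\<lambda>y. xc M d y $ m) x"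
  let ?s = "\<lambda>j y. crd F d y (s y) j"
  have "(\<Sum>k\<in>fidx F. coef F K c k i l x * crd F c x (s x) k)
      = (\<Sum>k\<in>fidx F. coef F K c k i l x * (\<Sum>j\<in>fidx F. ?T k j x * ?s j x))"
    by (intro sum.cong refl) (simp add: crd_change_chart[OF F d c section_in_fib])
  also have "\<dots> = (\<Sum>j\<in>fidx F. (\<Sum>k\<in>fidx F. coef F K c k i l x * ?T k j x) * ?s j x)"
    unfolding sum_distrib_left sum_distrib_right by (subst sum.swap) (simp add: mult_ac)
  also have "\<dots> = (\<Sum>j\<in>fidx F. (pd M c l (?T i j) x +
      (\<Sum>k\<in>fidx F. ?T i k x * (\<Sum>m\<in>UNIV. ?X m * coef F K d j k m x))) * ?s j x)"
    using K c d i by (intro sum.cong refl) (simp add: diff_connection_def)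
  also have "\<dots> = (\<Sum>j\<in>fidx F. pd M c l (?T i j) x * ?s j x) +
      (\<Sum>j\<in>fidx F. \<Sum>k\<in>fidx F. \<Sum>m\<in>UNIV. ?T i k x * ?X m * (coef F K d j k m x * ?s j x))"
    by (simp add: distrib_left distrib_right sum.distrib sum_distrib_left sum_distrib_right mult_ac)
  also have "(\<Sum>j\<in>fidx F. \<Sum>k\<in>fidx F. \<Sum>m\<in>UNIV. ?T i k x * ?X m * (coef F K d j k m x * ?s j x)) =
      (\<Sum>k\<in>fidx F. \<Sum>m\<in>UNIV. ?T i k x * ?X m * (\<Sum>j\<in>fidx F. coef F K d j k m x * ?s j x))"
  proof -
    have "(\<Sum>j\<in>fidx F. \<Sum>m\<in>UNIV. ?T i k x * ?X m * (coef F K d j k m x * ?s j x)) =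
        (\<Sum>m\<in>UNIV. ?T i k x * ?X m * (\<Sum>j\<in>fidx F. coef F K d j k m x * ?s j x))" for k
      unfolding sum_distrib_left by (rule sum.swap)
    then show ?thesis by (subst sum.swap) simp
  qed
  finally have K_part: "(\<Sum>k\<in>fidx F. coef F K c k i l x * crd F c x (s x) k) =
      (\<Sum>j\<in>fidx F. pd M c l (?T i j) x * ?s j x) +
      (\<Sum>k\<in>fidx F. \<Sum>m\<in>UNIV. ?T i k x * ?X m * (\<Sum>j\<in>fidx F. coef F K d j k m x * ?s j x))" .
  have "pd M c l (\<lambda>y. crd F c y (s y) i) x =
    (\<Sum>j\<in>fidx F. pd M c l (?T i j) x * ?s j x + ?T i j x * (\<Sum>m\<in>UNIV. ?X m * pd M d m (?s j) x))"
    by (rule pd_section_change_chart[OF F c d i open_UNIV]) (auto simp: section_in_fib section_diff_at d)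
  then show ?thesis
    unfolding cov_diff_components[OF c i] K_part
    by (simp add: cov_diff_components[OF d] right_diff_distrib sum_subtractf sum.distrib sum_distrib_left mult_ac)
qed

lemma cov_diff_in_sections: "cov_diff M F K s \<in> sections M (prod_bundle M F (cotangent_bundle M))"
proof -
  let ?I = "{Pair i a | i a. i \<in> fidx F \<and> a \<in> range Base}"
  have "cov_diff M F K s x \<in> fib (prod_bundle M F (cotangent_bundle M)) x" for x
    unfolding prod_bundle_fib bundle_selectors
  proof (intro conjI allI impI ballI)
    fix c d i and a :: "'n idx"
    assume c: "in_chart c x" and d: "in_chart d x" and i: "i \<in> fidx F" and "a \<in> range Base"
    then obtain l where a: "a = Base l" by blast
    show "cov_diff M F K s x c (Pair i a) = (\<Sum>j\<in>fidx F. \<Sum>b\<in>range Base.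
        trans_fn F c d x i j * trans_fn (cotangent_bundle M) c d x a b * cov_diff M F K s x d (Pair j b))"
      unfolding a cov_diff_change_chart[OF c d i] sum_range_Base trans_fn_cotangent[OF c d] by (rule refl)
  qed (rule cov_diff_eq_0)
  moreover have "smooth_in M c (cdom M c) (\<lambda>x. cov_diff M F K s x c k)"
    if c: "c \<in> charts M" and kI: "k \<in> ?I" for c k
  proof -
    obtain i l where k: "k = Pair i (Base l)" and i: "i \<in> fidx F" using kI by auto
    have "smooth_in M c (cdom M c) (\<lambda>x. pd M c l (\<lambda>y. crd F c y (s y) i) x -
        (\<Sum>j\<in>fidx F. coef F K c j i l x * crd F c x (s x) j))"
      using K i c open_cdom[OF c] unfolding diff_connection_def
      by (intro smooth_in_diff smooth_in_sum smooth_in_mult smooth_in_pd section_smooth finite_fidx[OF F]) auto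
    then show ?thesis
      unfolding k
      by (rule iffD2[OF smooth_in_cong[OF c open_cdom[OF c] order_refl], rotated])
        (use c i in \<open>simp add: cov_diff_components in_chart_def\<close>)
  qed
  ultimately show ?thesis by (simp add: sections_def bundle_selectors)
qed

section \<open>The Ricci identity\<close>

text \<open>The connection on $F \otimes T^*M$ contributes the dual of $\Gamma$ on the index of the first
  differentiation, whose coefficients are $-\Gamma$; hence the last term has a positive sign.\<close>

lemma second_cov_diff_components:
  fixes \<Gamma> :: "'m \<Rightarrow> ('c, 'n) arrays \<Rightarrow> ('c, 'n) jet"
  defines "u \<equiv> cov_diff M F K s"
  assumes c: "in_chart c x" and i: "i \<in> fidx F"
  shows "cov_diff M (prod_bundle M F (cotangent_bundle M))
      (prod_connection M F (cotangent_bundle M) K (dual_connection M (tangent_bundle M) \<Gamma>)) u x c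
      (Pair (Pair i (Base l)) (Base m)) =
    pd M c m (pd M c l (\<lambda>y. crd F c y (s y) i)) x
    - (\<Sum>j\<in>fidx F. pd M c m (coef F K c j i l) x * crd F c x (s x) j)
    - (\<Sum>j\<in>fidx F. coef F K c j i l x * pd M c m (\<lambda>y. crd F c y (s y) j) x)
    - (\<Sum>j\<in>fidx F. coef F K c j i m x * pd M c l (\<lambda>y. crd F c y (s y) j) x)
    + (\<Sum>j\<in>fidx F. \<Sum>k\<in>fidx F. coef F K c j k l x * coef F K c k i m x * crd F c x (s x) j)
    + (\<Sum>n\<in>UNIV. coef (tangent_bundle M) \<Gamma> c (Base l) (Base n) m x * u x c (Pair i (Base n)))"
proof -
  let ?s = "\<lambda>j y. crd F c y (s y) j"
  have c': "c \<in> charts M" "x \<in> cdom M c" using c by (auto simp: in_chart_def)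
  have A: "diff_at M c (coef F K c j i l) x" if "j \<in> fidx F" for j
    using K i c' that by (intro smooth_in_imp_diff_at[OF _ c'(2)]) (simp add: diff_connection_def)
  have ds: "diff_at M c (?s j) x" if "j \<in> fidx F" for j
    using section_diff_at[OF c that] .
  have dds: "diff_at M c (pd M c l (?s i)) x"
    using i by (intro smooth_in_imp_diff_at[OF _ c'(2)] smooth_in_pd[OF c'(1)] section_smooth c' open_cdom) auto
  have "pd M c m (\<lambda>y. u y c (Pair i (Base l))) x =
      pd M c m (\<lambda>y. pd M c l (?s i) y - (\<Sum>j\<in>fidx F. coef F K c j i l y * ?s j y)) x"
    unfolding u_def using i by (intro pd_cong[OF c open_UNIV]) (auto simp: cov_diff_components)
  also have "\<dots> = pd M c m (pd M c l (?s i)) x - pd M c m (\<lambda>y. \<Sum>j\<in>fidx F. coef F K c j i l y * ?s j y) x"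
    by (intro pd_diff dds diff_at_sum finite_fidx[OF F] diff_at_mult A ds c)
  also have "pd M c m (\<lambda>y. \<Sum>j\<in>fidx F. coef F K c j i l y * ?s j y) x =
      (\<Sum>j\<in>fidx F. pd M c m (\<lambda>y. coef F K c j i l y * ?s j y) x)"
    by (intro pd_sum finite_fidx[OF F] diff_at_mult A ds)
  also have "\<dots> = (\<Sum>j\<in>fidx F. pd M c m (coef F K c j i l) x * ?s j x + coef F K c j i l x * pd M c m (?s j) x)"
    by (intro sum.cong refl pd_mult A ds c)
  finally have du: "pd M c m (\<lambda>y. u y c (Pair i (Base l))) x = pd M c m (pd M c l (?s i)) x
    - ((\<Sum>j\<in>fidx F. pd M c m (coef F K c j i l) x * ?s j x) + (\<Sum>j\<in>fidx F. coef F K c j i l x * pd M c m (?s j) x))"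
    by (simp add: sum.distrib)
  have "(\<Sum>k\<in>fidx F. coef F K c k i m x * (\<Sum>j\<in>fidx F. coef F K c j k l x * ?s j x)) =
      (\<Sum>j\<in>fidx F. \<Sum>k\<in>fidx F. coef F K c j k l x * coef F K c k i m x * ?s j x)"
    unfolding sum_distrib_left by (subst sum.swap) (simp add: mult_ac)
  then have Ku: "(\<Sum>k\<in>fidx F. coef F K c k i m x * u x c (Pair k (Base l))) =
      (\<Sum>j\<in>fidx F. coef F K c j i m x * pd M c l (?s j) x) -
      (\<Sum>j\<in>fidx F. \<Sum>k\<in>fidx F. coef F K c j k l x * coef F K c k i m x * ?s j x)"
    unfolding u_def by (simp add: cov_diff_components[OF c] right_diff_distrib sum_subtractf)
  have \<Gamma>u: "(\<Sum>b\<in>fidx (cotangent_bundle M).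
      coef (cotangent_bundle M) (dual_connection M (tangent_bundle M) \<Gamma>) c b (Base l) m x * u x c (Pair i b)) =
    - (\<Sum>n\<in>UNIV. coef (tangent_bundle M) \<Gamma> c (Base l) (Base n) m x * u x c (Pair i (Base n)))"
    by (simp add: bundle_selectors sum_range_Base coef_dual[OF tangent_diff_bundle c] sum_negf)
  have il: "Pair i (Base l) \<in> fidx (prod_bundle M F (cotangent_bundle M))"
    using i by (simp add: bundle_selectors)
  have "Base l \<in> fidx (cotangent_bundle M)" by (simp add: bundle_selectors)
  note snd_C = prod_connection_Pair[OF F cotangent_diff_bundle c i this]
  show ?thesis
    unfolding cov_diff_Pair[OF c il] snd_C \<Gamma>u Ku unfolding bundle_selectors du by simp
qed

text \<open>Of the terms of $\nabla_\mu\nabla_\lambda s$, those with derivatives of s cancel in the antisymmetrisation: the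
  second derivatives commute, the first derivatives occur in the symmetric combination b l m + b m l, and the
  term with $\Gamma$ is symmetric since $\Gamma$ is. The rest are the derivatives (a) and the products (q) of the coefficients
  that make up the curvature.\<close>

lemma Alt_second_cov_diff:
  fixes \<Gamma> :: "'m \<Rightarrow> ('c, 'n) arrays \<Rightarrow> ('c, 'n) jet"
  assumes \<Gamma>: "classical_connection M \<Gamma>"
  shows "Alt (cov_diff M (prod_bundle M F (cotangent_bundle M))
      (prod_connection M F (cotangent_bundle M) K (dual_connection M (tangent_bundle M) \<Gamma>))
      (cov_diff M F K s)) x c k = - (1/2) * curvature M F K x (s x) c k"
    (is "Alt ?v x c k = _")
proof (cases "in_chart c x \<and> (\<exists>i l m. i \<in> fidx F \<and> k = Pair (Pair i (Base l)) (Base m))")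
  case False
  have "?v x c (Pair (Pair i a) b) = 0 \<and> ?v x c (Pair (Pair i b) a) = 0" if "k = Pair (Pair i a) b" for i a b
    using False that by (auto intro!: cov_diff_eq_0 simp: bundle_selectors)
  then have "Alt ?v x c k = 0"
    unfolding Alt_def by (auto split: idx.split)
  moreover have "curvature M F K x (s x) c k = 0"
    using False by (auto simp: curvature_def in_chart_def split: idx.split)
  ultimately show ?thesis by simp
next
  case True
  then obtain i l m where c: "in_chart c x" and i: "i \<in> fidx F" and k: "k = Pair (Pair i (Base l)) (Base m)"
    by blast
  let ?s = "\<lambda>j y. crd F c y (s y) j"
  define a where "a = (\<lambda>l m. \<Sum>j\<in>fidx F. pd M c m (coef F K c j i l) x * ?s j x)"
  define b where "b = (\<lambda>l m. \<Sum>j\<in>fidx F. coef F K c j i l x * pd M c m (?s j) x)"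
  define q where "q = (\<lambda>l m. \<Sum>j\<in>fidx F. \<Sum>k\<in>fidx F. coef F K c j k l x * coef F K c k i m x * ?s j x)"
  define g where "g = (\<lambda>l m. \<Sum>n\<in>UNIV. coef (tangent_bundle M) \<Gamma> c (Base l) (Base n) m x *
    cov_diff M F K s x c (Pair i (Base n)))"
  have v: "?v x c (Pair (Pair i (Base l)) (Base m)) =
      pd M c m (pd M c l (?s i)) x - a l m - b l m - b m l + q l m + g l m" for l m
    unfolding a_def b_def q_def g_def by (rule second_cov_diff_components[OF c i])
  have R: "(\<Sum>j\<in>fidx F. curv_coef M F K c j i l m x * ?s j x) = a l m - a m l + q m l - q l m"
    unfolding a_def q_def curv_coef_def
    by (simp add: distrib_right left_diff_distrib sum.distrib sum_subtractf sum_distrib_right)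
  have "pd M c m (pd M c l (?s i)) x = pd M c l (pd M c m (?s i)) x"
    using c i by (intro pd_commute section_smooth) (auto simp: in_chart_def)
  moreover have "g l m = g m l"
    using \<Gamma> c unfolding g_def classical_connection_def in_chart_def
    by (intro sum.cong refl arg_cong2[where f = "(*)"]) blast+
  moreover have "curvature M F K x (s x) c k = (\<Sum>j\<in>fidx F. curv_coef M F K c j i l m x * ?s j x)"
    using c i by (simp add: curvature_def k in_chart_def)
  moreover have "Alt ?v x c k =
      (?v x c (Pair (Pair i (Base l)) (Base m)) - ?v x c (Pair (Pair i (Base m)) (Base l))) / 2"
    by (simp add: Alt_def k)
  ultimately show ?thesis unfolding v R by (simp add: field_simps)
qed

end

text \<open>The two last factors are the same bundle, so exchanging their labels commutes with the
  transition matrices.\<close>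

lemma Alt_in_sections:
  assumes F: "diff_bundle F" and H: "diff_bundle H"
    and v: "v \<in> sections M (prod_bundle M (prod_bundle M F H) H)"
  shows "Alt v \<in> sections M (prod_bundle M (prod_bundle M F H) H)"
proof -
  let ?P = "prod_bundle M F H"
  let ?B = "prod_bundle M ?P H"
  have B: "diff_bundle ?B" by (intro prod_diff_bundle F H)
  have vfib: "v x \<in> fib ?B x" for x using v by (simp add: sections_def)
  have Alt: "Alt v x c (Pair (Pair i a) b) = (v x c (Pair (Pair i a) b) - v x c (Pair (Pair i b) a)) / 2" for x c i a b
    by (simp add: Alt_def)
  have expand: "v x c (Pair (Pair i a) b) = (\<Sum>j\<in>fidx F. \<Sum>a'\<in>fidx H. \<Sum>b'\<in>fidx H.
      trans_fn F c d x i j * trans_fn H c d x a a' * trans_fn H c d x b b' * v x d (Pair (Pair j a') b'))"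
    if c: "in_chart c x" and d: "in_chart d x" and "i \<in> fidx F" "a \<in> fidx H" "b \<in> fidx H" for c d x i a b
    using crd_change_chart[OF B d c vfib, of "Pair (Pair i a) b"] that(3-5)
    unfolding bundle_selectors sum_Pair
    by (simp add: bundle_selectors trans_fn_prod[OF prod_diff_bundle[OF F H] H c d] trans_fn_prod[OF F H c d])
  have "Alt v x \<in> fib ?B x" for x
    unfolding prod_bundle_fib
  proof (intro conjI allI impI ballI)
    fix c k assume k: "\<not> in_chart c x \<or> k \<notin> {Pair i a | i a. i \<in> fidx ?P \<and> a \<in> fidx H}"
    have "v x c (Pair (Pair i a) b) = 0 \<and> v x c (Pair (Pair i b) a) = 0" if "k = Pair (Pair i a) b" for i a b
      using k that by (intro conjI vfib[unfolded prod_bundle_fib, THEN conjunct1, rule_format])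
        (auto simp: bundle_selectors)
    then show "Alt v x c k = 0" unfolding Alt_def by (simp split: idx.split)
  next
    fix c d p b assume c: "in_chart c x" and d: "in_chart d x" and "p \<in> fidx ?P" and b: "b \<in> fidx H"
    then obtain i a where p: "p = Pair i a" and i: "i \<in> fidx F" and a: "a \<in> fidx H"
      unfolding bundle_selectors by blast
    let ?T = "\<lambda>j a' b'. trans_fn F c d x i j * trans_fn H c d x a a' * trans_fn H c d x b b'"
    have "v x c (Pair (Pair i b) a) = (\<Sum>j\<in>fidx F. \<Sum>a'\<in>fidx H. \<Sum>b'\<in>fidx H. ?T j a' b' * v x d (Pair (Pair j b') a'))"
      unfolding expand[OF c d i b a] by (rule sum.cong[OF refl], subst sum.swap, simp add: mult_ac)
    then have "Alt v x c (Pair (Pair i a) b) =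
        (\<Sum>j\<in>fidx F. \<Sum>a'\<in>fidx H. \<Sum>b'\<in>fidx H. ?T j a' b' * Alt v x d (Pair (Pair j a') b'))"
      unfolding Alt expand[OF c d i a b]
      by (simp add: right_diff_distrib diff_divide_distrib sum_subtractf sum_divide_distrib)
    then show "Alt v x c (Pair p b) = (\<Sum>q\<in>fidx ?P. \<Sum>b'\<in>fidx H.
        trans_fn ?P c d x p q * trans_fn H c d x b b' * Alt v x d (Pair q b'))"
      unfolding bundle_selectors sum_Pair p using i a by (simp add: trans_fn_prod[OF F H c d])
  qed
  moreover have "smooth_in M c (cdom M c) (\<lambda>x. Alt v x c k)" if c: "c \<in> charts M" and k: "k \<in> fidx ?B" for c k
  proof -
    obtain i a b where k: "k = Pair (Pair i a) b" and "Pair (Pair i a) b \<in> fidx ?B" "Pair (Pair i b) a \<in> fidx ?B"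
      using k unfolding bundle_selectors by blast
    then have "smooth_in M c (cdom M c) (\<lambda>x. v x c (Pair (Pair i a) b))"
      "smooth_in M c (cdom M c) (\<lambda>x. v x c (Pair (Pair i b) a))"
      using v c unfolding sections_def bundle_selectors(8) by blast+
    from smooth_in_mult[OF c smooth_in_diff[OF c this] smooth_in_const[of c _ "1/2"]]
    show ?thesis unfolding k Alt by simp
  qed
  ultimately show ?thesis unfolding sections_def bundle_selectors(8) by blast
qed

end

theorem theorem4p7:
  fixes M :: "('c, 'm::{t2_space, second_countable_topology}, 'n::finite) manifold"
    and E :: "('c, 'm, 'n, 'v) vbundle"
    and K :: "'m \<Rightarrow> 'v \<Rightarrow> ('c, 'n) jet"
    and \<Gamma> :: "'m \<Rightarrow> ('c, 'n) arrays \<Rightarrow> ('c, 'n) jet"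
    and \<Phi> :: "'m \<Rightarrow> ('c, 'n) arrays"
    and p q r s :: nat
  assumes "smooth_manifold M"
    and "vector_bundle M E"
    and "linear_connection M E K"
    and "classical_connection M \<Gamma>"
    and "\<Phi> \<in> sections M (tensor_bundle M E p q r s)"
  shows "Alt (nabla M E K \<Gamma> p q r (Suc s) (nabla M E K \<Gamma> p q r s \<Phi>)) =
           (\<lambda>x c k. - (1/2) *
              curvature M (tensor_bundle M E p q r s) (tensor_connection M E K \<Gamma> p q r s) x (\<Phi> x) c k)
         \<and> Alt (nabla M E K \<Gamma> p q r (Suc s) (nabla M E K \<Gamma> p q r s \<Phi>))
           \<in> sections_wedge2 M (tensor_bundle M E p q r s)"
proof -
  interpret smooth_atlas M by unfold_locales (rule assms(1))
  let ?F = "tensor_bundle M E p q r" and ?K = "tensor_connection M E K \<Gamma> p q r"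
  let ?\<Phi> = "nabla M E K \<Gamma> p q r (Suc s) (nabla M E K \<Gamma> p q r s \<Phi>)"
  have E: "diff_bundle E" by (rule vector_bundle_imp_diff_bundle[OF assms(2)])
  have K: "diff_connection E K" by (rule linear_connection_imp_diff_connection[OF E assms(3)])
  have \<Gamma>: "diff_connection (tangent_bundle M) \<Gamma>"
    using linear_connection_imp_diff_connection[OF tangent_diff_bundle] assms(4)
    by (simp add: classical_connection_def)
  note F = tensor_diff_bundle[OF E, of p q r] and C = tensor_diff_connection[OF E K \<Gamma>, of p q r]
  have "Alt ?\<Phi> x c k = - (1/2) * curvature M (?F s) (?K s) x (\<Phi> x) c k" for x c k
    using Alt_second_cov_diff[OF F C assms(5,4)]
    by (simp add: nabla_def tensor_bundle_Suc tensor_connection_Suc)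
  moreover have "?\<Phi> \<in> sections M (?F (Suc (Suc s)))"
    unfolding nabla_def tensor_bundle_Suc[of E p q r "Suc s"] using assms(5)
    by (intro cov_diff_in_sections F C) (simp add: tensor_bundle_Suc cov_diff_in_sections F C)
  then have "Alt ?\<Phi> \<in> sections M (?F (Suc (Suc s)))"
    unfolding tensor_bundle_Suc by (intro Alt_in_sections F cotangent_diff_bundle)
  then have "Alt ?\<Phi> \<in> sections_wedge2 M (?F s)"
    unfolding sections_wedge2_def tensor_bundle_Suc by (simp add: Alt_def field_simps)
  ultimately show ?thesis by blast
qed

end
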